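(* $W[X_3]$ is widely-connected and completely metrizable.
   Context: $C$ is the middle-thirds Cantor set in $[0,1]$ and $\omega=\{0,1,2,\dots\}$. A connected space (with more than one point) is *widely-connected* if every connected subset of it with more than one point is dense in it. Definition of $X_3$. The non-endpoints of $C$ are the points of $C$ other than $0$, $1$ and the endpoints of the open intervals removed from $[0,1]$ in constructing $C$. Fix a countable set $D=\{d_n:n<\omega\}$ of non-endpoints of $C$ (enumerated without repetition) that is dense in $C$, and a sequence $(a_n)_{n<\omega}$ of positive real numbers with $\sum_{n=0}^\infty a_n=1$. Define $f:C\to[0,1]$ by $f(c)=\sum_{\{n<\omega:\,d_n<c\}}a_n$. Let $\mathbb Q=\{q_n:n<\omega\}$ be an enumeration of the rationals. Write $\mathrm{Gr}(f+q_n)=\{\langle c,f(c)+q_n\rangle:c\in C\}$, and let the overline denote closure in $C\times\mathbb R$. Put $$Y=(C\times\mathbb R)\setminus\bigcup_{n<\omega}\overline{\mathrm{Gr}(f+q_n)},\qquad \Xi:C\times\mathbb R\to C\times(0,1),\ \ \Xi(\langle c,r\rangle)=\Big\langle c,\tfrac{\arctan(r)}{\pi}+\tfrac12\Big\rangle,\qquad X_3=\Xi[Y].$$ Definition of $W[X]$. $K\subseteq[0,1]^2$ is the (rectilinear) Knaster bucket-handle continuum, $\Delta=\{\langle x,x\rangle\in K:x\in[0,1]\}$ is its diagonal Cantor set, and $K\setminus\Delta=\bigcup_{i<\omega}K_i$ is the disjoint union of open copies $K_i$ of $C\times(0,1)$, with homeomorphisms $\varphi_i:C\times(0,1)\to K_i$.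 Explicitly, $\Delta=\{\langle x,x\rangle:x\in C\}$, and the maps are as follows. - For $i=0$ and $c\in C$, put $x=c/3$ and $y=1-x$. Then $\varphi_0(c,t)=\langle x,\,x+2t(y-x)\rangle$ for $0<t\le 1/2$, and $\varphi_0(c,t)=\langle x+(2t-1)(y-x),\,y\rangle$ for $1/2\le t<1$. - For $i\ge1$ and $c\in C$, put $x=2/3^i+c/3^{i+1}$ and $y=5/3^i-x$. Then $\varphi_i(c,t)=\langle x+2t(y-x),\,x\rangle$ for $0<t\le1/2$, and $\varphi_i(c,t)=\langle y,\,x+(2t-1)(y-x)\rangle$ for $1/2\le t<1$. Put $K_i=\varphi_i[C\times(0,1)]$ and $K=\Delta\cup\bigcup_{i<\omega}K_i$. For $X\subseteq C\times(0,1)$ define $W[X]=\Delta\cup\bigcup_{i<\omega}\varphi_i[X]$, with the subspace topology from $K\subseteq\mathbb R^2$. *)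

theory Defs
  imports "HOL-Analysis.Analysis"
begin

text \<open>A pair \<open>(a, b)\<close> stands for a closed interval \<open>{a..b}\<close> that occurs at some stage
  of the middle-thirds construction.\<close>

inductive_set cantor_intervals :: "(real \<times> real) set" where
  unit: "(0, 1) \<in> cantor_intervals"
| left: "(a, b) \<in> cantor_intervals \<Longrightarrow> (a, (2 * a + b) / 3) \<in> cantor_intervals"
| right: "(a, b) \<in> cantor_intervals \<Longrightarrow> ((a + 2 * b) / 3, b) \<in> cantor_intervals"

definition cantor_gaps :: "(real \<times> real) set" where
  "cantor_gaps = (\<lambda>(a, b). ((2 * a + b) / 3, (a + 2 * b) / 3)) ` cantor_intervals"

definition cantor :: "real set" where
  "cantor = {0..1} - (\<Union>(a, b)\<in>cantor_gaps. {a<..<b})"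

definition cantor_nonendpoints :: "real set" where
  "cantor_nonendpoints = cantor - ({0, 1} \<union> fst ` cantor_gaps \<union> snd ` cantor_gaps)"

definition jump_fun :: "(nat \<Rightarrow> real) \<Rightarrow> (nat \<Rightarrow> real) \<Rightarrow> real \<Rightarrow> real" where
  "jump_fun d a c = (\<Sum>\<^sub>\<infinity>n\<in>{n. d n < c}. a n)"

definition cantor_graph :: "(real \<Rightarrow> real) \<Rightarrow> (real \<times> real) set" where
  "cantor_graph g = {(c, g c) | c. c \<in> cantor}"

definition Y_set :: "(nat \<Rightarrow> real) \<Rightarrow> (nat \<Rightarrow> real) \<Rightarrow> (nat \<Rightarrow> real) \<Rightarrow> (real \<times> real) set" where
  "Y_set d a q = cantor \<times> UNIV -
     (\<Union>n. top_of_set (cantor \<times> UNIV) closure_of cantor_graph (\<lambda>c. jump_fun d a c + q n))"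

definition Xi :: "real \<times> real \<Rightarrow> real \<times> real" where
  "Xi = (\<lambda>(c, r). (c, arctan r / pi + 1 / 2))"

definition X3 :: "(nat \<Rightarrow> real) \<Rightarrow> (nat \<Rightarrow> real) \<Rightarrow> (nat \<Rightarrow> real) \<Rightarrow> (real \<times> real) set" where
  "X3 d a q = Xi ` Y_set d a q"

text \<open>The homeomorphisms from \<open>cantor \<times> {0<..<1}\<close> onto the open pieces of the rectilinear
  bucket-handle continuum. Each fibre \<open>{c} \<times> {0<..<1}\<close> becomes an L-shaped arc whose missing
  ends are \<open>(x, x)\<close> and \<open>(y, y)\<close> on the diagonal; only the values on
  \<open>cantor \<times> {0<..<1}\<close> are relevant.\<close>

definition knaster_chart :: "nat \<Rightarrow> real \<times> real \<Rightarrow> real \<times> real" where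
  "knaster_chart i = (\<lambda>(c, t).
     if i = 0 then
       (let x = c / 3; y = 1 - x in
         if t \<le> 1 / 2 then (x, x + 2 * t * (y - x)) else (x + (2 * t - 1) * (y - x), y))
     else
       (let x = 2 / 3 ^ i + c / 3 ^ (i + 1); y = 5 / 3 ^ i - x in
         if t \<le> 1 / 2 then (x + 2 * t * (y - x), x) else (y, x + (2 * t - 1) * (y - x))))"

definition knaster_diagonal :: "(real \<times> real) set" where
  "knaster_diagonal = {(x, x) | x. x \<in> cantor}"

definition W_set :: "(real \<times> real) set \<Rightarrow> (real \<times> real) set" where
  "W_set X = knaster_diagonal \<union> (\<Union>i. knaster_chart i ` X)"

definition knaster :: "(real \<times> real) set" where
  "knaster = knaster_diagonal \<union> (\<Union>i. knaster_chart i ` (cantor \<times> {0<..<1}))"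

definition W_space :: "(real \<times> real) set \<Rightarrow> (real \<times> real) topology" where
  "W_space X = subtopology (top_of_set knaster) (W_set X)"

definition widely_connected_space :: "'a topology \<Rightarrow> bool" where
  "widely_connected_space T \<longleftrightarrow>
     connected_space T \<and>
     (\<exists>x\<in>topspace T. \<exists>y\<in>topspace T. x \<noteq> y) \<and>
     (\<forall>S. connectedin T S \<and> (\<exists>x\<in>S. \<exists>y\<in>S. x \<noteq> y) \<longrightarrow> T closure_of S = topspace T)"

end

theory Submission
  imports Defs
begin

text \<open>
  Write \<open>f_right\<close> for the right limit of the jump function \<open>f\<close>. The closure \<open>\<Gamma> r\<close> of the graph of
  \<open>f + r\<close> meets the vertical line over \<open>c\<close> only at the heights \<open>f c + r\<close> and \<open>f_right c + r\<close>, and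
  these differ exactly when \<open>c\<close> is one of the jump points \<open>d n\<close>. Each \<open>\<Gamma> r\<close> is compact, so the
  space \<open>W\<close> of the theorem is the compact Knaster continuum minus the countably many compact sets
  \<open>hole i n\<close>, the copies of \<open>\<Gamma> (q n)\<close> in the \<open>i\<close>-th family of arcs. In particular it is a
  \<open>G\<^sub>\<delta>\<close> set in a compact metric space and hence completely metrizable.

  \<^bold>\<open>Connectedness.\<close> The continuum is connected because all of its long arcs end in an arbitrarily
  small core at the origin (\<open>connected_knaster\<close>), and \<open>W\<close> is dense in it. A separation of \<open>W\<close>
  into \<open>A\<close> and \<open>B\<close> therefore leaves a nonempty closed set \<open>F\<close> of common limit points of \<open>A\<close> and \<open>B\<close>,
  and \<open>F\<close> is covered by the holes. By the Baire category theorem a nonempty relatively open part of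
  \<open>F\<close> lies in a single hole. In the coordinates of that hole, some box minus \<open>\<Gamma> r\<close> is thus split by
  the closures of \<open>A\<close> and \<open>B\<close>. This is impossible (\<open>box_minus_Gamma_unsplit\<close>): the jumps of \<open>f\<close>
  leave gaps in \<open>\<Gamma> r\<close> over a dense set of points \<open>d n\<close>, and a point in such a gap is a limit of
  points above \<open>\<Gamma> r\<close> from the left and of points below \<open>\<Gamma> r\<close> from the right.

  \<^bold>\<open>Wide connectedness.\<close> Let \<open>S\<close> be a connected subset of \<open>W\<close> that is not dense. Some open set meets
  the continuum but misses \<open>S\<close>, and by the folding structure it contains a whole cross section of the
  long arcs of some level (\<open>open_contains_cross_section\<close>). Once the continuum is cut along this
  cross section, the points of \<open>S\<close> share one label (\<open>connected_cut_label\<close>), and only finitely many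
  long arcs carry a given label (\<open>finite_same_label\<close>). On each single arc, though, the complement
  of \<open>W\<close> is dense, because the rationals \<open>q n\<close> are; so \<open>S\<close> can be cut around any of its points and
  consists of at most one point (\<open>connected_with_holes_singleton\<close>).
\<close>

section \<open>The Cantor set\<close>

lemma cantor_intervals_scale:
  assumes "(a, b) \<in> cantor_intervals"
  shows "(a / 3, b / 3) \<in> cantor_intervals" "((a + 2) / 3, (b + 2) / 3) \<in> cantor_intervals"
    "(1 - b, 1 - a) \<in> cantor_intervals"
  using assms
proof (induction a b rule: cantor_intervals.induct)
  case unit
  { case 1 show ?case using cantor_intervals.left[OF cantor_intervals.unit] by simp }
  { case 2 show ?case using cantor_intervals.right[OF cantor_intervals.unit] by simp }
  { case 3 show ?case using cantor_intervals.unit by simp }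
next
  case (left a b)
  { case 1 show ?case using cantor_intervals.left[OF left(2)] by (simp add: field_simps) }
  { case 2
    have "((a + 2) / 3, (2 * ((a + 2) / 3) + (b + 2) / 3) / 3) = ((a + 2) / 3, ((2 * a + b) / 3 + 2) / 3)"
      by (simp add: add_divide_distrib)
    then show ?case using cantor_intervals.left[OF left(3)] by argo }
  { case 3 show ?case using cantor_intervals.right[OF left(4)] by (simp add: field_simps) }
next
  case (right a b)
  { case 1 show ?case using cantor_intervals.right[OF right(2)] by (simp add: field_simps) }
  { case 2
    have "(((a + 2) / 3 + 2 * ((b + 2) / 3)) / 3, (b + 2) / 3) = (((a + 2 * b) / 3 + 2) / 3, (b + 2) / 3)"
      by (simp add: add_divide_distrib)
    then show ?case using cantor_intervals.right[OF right(3)] by argo }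
  { case 3 show ?case using cantor_intervals.left[OF right(4)] by (simp add: field_simps) }
qed

lemma cantor_intervals_unscale:
  assumes "(a, b) \<in> cantor_intervals"
  shows "(a, b) = (0, 1) \<or> (3 * a, 3 * b) \<in> cantor_intervals \<or> (3 * a - 2, 3 * b - 2) \<in> cantor_intervals"
  using assms
proof (induction a b rule: cantor_intervals.induct)
  case unit then show ?case by simp
next
  case (left a b)
  from left(2) show ?case
  proof (elim disjE)
    assume "(a, b) = (0, 1)" then show ?thesis using cantor_intervals.unit by simp
  next
    assume "(3 * a, 3 * b) \<in> cantor_intervals"
    from cantor_intervals.left[OF this] show ?thesis by (simp add: field_simps)
  next
    assume "(3 * a - 2, 3 * b - 2) \<in> cantor_intervals"
    from cantor_intervals.left[OF this] show ?thesis by (simp add: field_simps)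
  qed
next
  case (right a b)
  from right(2) show ?case
  proof (elim disjE)
    assume "(a, b) = (0, 1)" then show ?thesis using cantor_intervals.unit by simp
  next
    assume "(3 * a, 3 * b) \<in> cantor_intervals"
    from cantor_intervals.right[OF this] show ?thesis by (simp add: field_simps)
  next
    assume "(3 * a - 2, 3 * b - 2) \<in> cantor_intervals"
    from cantor_intervals.right[OF this] show ?thesis by (simp add: field_simps)
  qed
qed

lemma cantor_gaps_iff:
  "(u, v) \<in> cantor_gaps \<longleftrightarrow> (\<exists>a b. (a, b) \<in> cantor_intervals \<and> u = (2 * a + b) / 3 \<and> v = (a + 2 * b) / 3)"
  unfolding cantor_gaps_def by force

lemma cantor_gaps_scale:
  assumes "(u, v) \<in> cantor_gaps"
  shows "(u / 3, v / 3) \<in> cantor_gaps" "((u + 2) / 3, (v + 2) / 3) \<in> cantor_gaps"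
    "(1 - v, 1 - u) \<in> cantor_gaps"
proof -
  obtain a b where ab: "(a, b) \<in> cantor_intervals" "u = (2 * a + b) / 3" "v = (a + 2 * b) / 3"
    using assms unfolding cantor_gaps_iff by blast
  show "(u / 3, v / 3) \<in> cantor_gaps" unfolding cantor_gaps_iff
    by (rule exI[of _ "a/3"], rule exI[of _ "b/3"]) (use ab cantor_intervals_scale in auto)
  show "((u + 2) / 3, (v + 2) / 3) \<in> cantor_gaps" unfolding cantor_gaps_iff
    by (rule exI[of _ "(a + 2)/3"], rule exI[of _ "(b + 2)/3"]) (use ab cantor_intervals_scale in \<open>auto simp: add_divide_distrib\<close>)
  show "(1 - v, 1 - u) \<in> cantor_gaps" unfolding cantor_gaps_iff
    by (rule exI[of _ "1-b"], rule exI[of _ "1-a"]) (use ab cantor_intervals_scale in \<open>auto simp: field_simps\<close>)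
qed

lemma cantor_gaps_middle: "(1/3, 2/3) \<in> cantor_gaps"
  unfolding cantor_gaps_iff using cantor_intervals.unit by force

lemma cantor_gaps_unscale:
  assumes "(u, v) \<in> cantor_gaps"
  shows "(u, v) = (1/3, 2/3) \<or> (3 * u, 3 * v) \<in> cantor_gaps \<or> (3 * u - 2, 3 * v - 2) \<in> cantor_gaps"
proof -
  obtain a b where ab: "(a, b) \<in> cantor_intervals" "u = (2 * a + b) / 3" "v = (a + 2 * b) / 3"
    using assms unfolding cantor_gaps_iff by blast
  from cantor_intervals_unscale[OF ab(1)] show ?thesis
  proof (elim disjE)
    assume "(a, b) = (0, 1)" then show ?thesis using ab by simp
  next
    assume "(3 * a, 3 * b) \<in> cantor_intervals"
    then have "(3 * u, 3 * v) \<in> cantor_gaps" unfolding cantor_gaps_iff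
      by (intro exI[of _ "3*a"] exI[of _ "3*b"]) (use ab in auto)
    then show ?thesis by simp
  next
    assume "(3 * a - 2, 3 * b - 2) \<in> cantor_intervals"
    then have "(3 * u - 2, 3 * v - 2) \<in> cantor_gaps" unfolding cantor_gaps_iff
      by (intro exI[of _ "3*a-2"] exI[of _ "3*b-2"]) (use ab in auto)
    then show ?thesis by simp
  qed
qed

lemma cantor_iff: "x \<in> cantor \<longleftrightarrow> 0 \<le> x \<and> x \<le> 1 \<and> (\<forall>u v. (u, v) \<in> cantor_gaps \<longrightarrow> x \<le> u \<or> v \<le> x)"
  unfolding cantor_def by force

lemma cantor_bounds: "x \<in> cantor \<Longrightarrow> 0 \<le> x" "x \<in> cantor \<Longrightarrow> x \<le> 1"
  by (auto simp: cantor_iff)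

lemma cantor_gaps_bounds:
  assumes "(u, v) \<in> cantor_gaps" shows "0 \<le> u" "u < v" "v \<le> 1"
proof -
  have *: "0 \<le> a \<and> a < b \<and> b \<le> 1" if "(a, b) \<in> cantor_intervals" for a b
    using that by (induction a b rule: cantor_intervals.induct) auto
  obtain a b where ab: "(a, b) \<in> cantor_intervals" "u = (2 * a + b) / 3" "v = (a + 2 * b) / 3"
    using assms unfolding cantor_gaps_iff by blast
  show "0 \<le> u" "u < v" "v \<le> 1" using *[OF ab(1)] ab by auto
qed

lemma cantor_middle: "x \<in> cantor \<Longrightarrow> x \<le> 1/3 \<or> 2/3 \<le> x"
  using cantor_gaps_middle unfolding cantor_iff by blast

lemma cantor_flip: "x \<in> cantor \<Longrightarrow> 1 - x \<in> cantor"
proof -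
  assume x: "x \<in> cantor"
  have "1 - x \<le> u \<or> v \<le> 1 - x" if "(u, v) \<in> cantor_gaps" for u v
  proof -
    have "x \<le> 1 - v \<or> 1 - u \<le> x" using cantor_gaps_scale(3)[OF that] x by (simp add: cantor_iff)
    then show ?thesis by linarith
  qed
  then show ?thesis using x by (simp add: cantor_iff)
qed

lemma cantor_third: assumes "x \<in> cantor" shows "x / 3 \<in> cantor"
proof -
  have "x / 3 \<le> u \<or> v \<le> x / 3" if uv: "(u, v) \<in> cantor_gaps" for u v
    using cantor_gaps_unscale[OF uv]
  proof (elim disjE)
    assume "(u, v) = (1/3, 2/3)" then show ?thesis using assms by (simp add: cantor_iff)
  next
    assume "(3 * u, 3 * v) \<in> cantor_gaps"
    then have "x \<le> 3 * u \<or> 3 * v \<le> x" using assms by (auto simp: cantor_iff)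
    then show ?thesis by linarith
  next
    assume "(3 * u - 2, 3 * v - 2) \<in> cantor_gaps"
    then show ?thesis using cantor_gaps_bounds(1)[of "3 * u - 2" "3 * v - 2"] cantor_bounds[OF assms] by auto
  qed
  then show ?thesis using cantor_bounds[OF assms] by (simp add: cantor_iff)
qed

lemma cantor_flip_third: "x \<in> cantor \<Longrightarrow> 1 - x / 3 \<in> cantor"
  by (simp add: cantor_third cantor_flip)

text \<open>Together with \<open>cantor_third\<close> and \<open>cantor_flip_third\<close> this is the self-similarity of the
  Cantor set. The right third is parametrized in reverse, \<open>b \<mapsto> 1 - b / 3\<close>, because that is how the arcs
  of the continuum fold.\<close>

lemma cantor_cases:
  assumes "x \<in> cantor"
  obtains b where "b \<in> cantor" "x = b / 3" | b where "b \<in> cantor" "x = 1 - b / 3"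
proof -
  have low: "3 * x \<in> cantor" if x: "x \<in> cantor" "x \<le> 1/3" for x
  proof -
    have "3 * x \<le> u \<or> v \<le> 3 * x" if "(u, v) \<in> cantor_gaps" for u v
    proof -
      have "x \<le> u / 3 \<or> v / 3 \<le> x" using cantor_gaps_scale(1)[OF that] x unfolding cantor_iff by blast
      then show ?thesis by linarith
    qed
    then show ?thesis using x by (simp add: cantor_iff)
  qed
  from cantor_middle[OF assms] show ?thesis
  proof
    assume "x \<le> 1/3"
    then show ?thesis using that(1)[of "3 * x"] low[OF assms] by simp
  next
    assume "2/3 \<le> x"
    then show ?thesis using that(2)[of "3 * (1 - x)"] low[OF cantor_flip[OF assms]]
      by (simp add: diff_divide_distrib)
  qed
qed

lemma cantor_zero: "0 \<in> cantor" and cantor_one: "1 \<in> cantor"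
proof -
  show "0 \<in> cantor" using cantor_gaps_bounds by (auto simp: cantor_iff)
  then show "1 \<in> cantor" using cantor_flip by fastforce
qed

lemma compact_cantor: "compact cantor"
proof -
  have "cantor = {0..1} - (\<Union>g\<in>cantor_gaps. {fst g<..<snd g})"
    unfolding cantor_def by (auto simp: case_prod_beta)
  moreover have "open (\<Union>g\<in>cantor_gaps. {fst g<..<snd g})" by auto
  ultimately show ?thesis using compact_diff[OF compact_Icc] by metis
qed

lemma closed_cantor: "closed cantor"
  by (simp add: compact_cantor compact_imp_closed)

text \<open>Rescaling by 3 enlarges the distance of two points in the same third until the points lie in
  different thirds, where the middle point separates them.\<close>

lemma cantor_separated:
  assumes "l \<in> cantor" "l' \<in> cantor" "l < l'"
  shows "\<exists>v. l < v \<and> v < l' \<and> v \<notin> cantor"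
proof -
  obtain k where "1 / (3::real) ^ k < l' - l"
    using real_arch_pow_inv[of "l' - l" "1/3"] assms by (auto simp: power_divide)
  then have "1 / 3 ^ k \<le> l' - l" by simp
  then show ?thesis using assms
  proof (induction k arbitrary: l l')
    case 0
    then have "l = 0" "l' = 1" using cantor_bounds[of l] cantor_bounds[of l'] by auto
    then show ?case using cantor_middle[of "1/2"] by (intro exI[of _ "1/2"]) auto
  next
    case (Suc k)
    have mid: ?case if "l \<le> 1/3" "2/3 \<le> l'"
    proof -
      have "l < 1/2" "1/2 < l'" using that by linarith+
      moreover have "(1/2::real) \<notin> cantor" using cantor_middle[of "1/2"] by linarith
      ultimately show ?case by (intro exI[of _ "1/2"] conjI)
    qed
    from Suc.prems(2) show ?case
    proof (cases rule: cantor_cases)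
      case (1 b)
      note l = this
      from Suc.prems(3) show ?thesis
      proof (cases rule: cantor_cases)
        case (1 b')
        have "1 / 3 ^ k \<le> b' - b" using Suc.prems l 1 by (simp add: field_simps)
        then have "\<exists>v. b < v \<and> v < b' \<and> v \<notin> cantor"
          by (rule Suc.IH) (use l 1 Suc.prems in auto)
        then obtain v where v: "b < v" "v < b'" "v \<notin> cantor" by blast
        have "v / 3 \<notin> cantor"
        proof
          assume "v / 3 \<in> cantor"
          then show False
          proof (cases rule: cantor_cases)
            case (1 z) then show ?thesis using v by simp
          next
            case (2 z) then show ?thesis using v cantor_bounds[of b'] cantor_bounds[of z] \<open>b' \<in> cantor\<close> by auto
          qed
        qed
        then show ?thesis using v l 1 by (intro exI[of _ "v/3"]) auto
      next
        case (2 b')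
        then show ?thesis using mid l cantor_bounds[of b] cantor_bounds[of b'] by auto
      qed
    next
      case (2 b)
      note l = this
      from Suc.prems(3) show ?thesis
      proof (cases rule: cantor_cases)
        case (1 b')
        then show ?thesis using Suc.prems l cantor_bounds[of b] cantor_bounds[of b'] by auto
      next
        case (2 b')
        have "1 / 3 ^ k \<le> b - b'" using Suc.prems l 2 by (simp add: field_simps)
        then have "\<exists>v. b' < v \<and> v < b \<and> v \<notin> cantor"
          by (rule Suc.IH) (use l 2 Suc.prems in auto)
        then obtain v where v: "b' < v" "v < b" "v \<notin> cantor" by blast
        have "1 - v / 3 \<notin> cantor"
        proof
          assume "1 - v / 3 \<in> cantor"
          then show False
          proof (cases rule: cantor_cases)
            case (2 z) then show ?thesis using v by simp
          next
            case (1 z) then show ?thesis using v cantor_bounds[of b] cantor_bounds[of z] \<open>b \<in> cantor\<close> by auto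
          qed
        qed
        then show ?thesis using v l 2 by (intro exI[of _ "1 - v/3"]) auto
      qed
    qed
  qed
qed

text \<open>By self-similarity a good approximation of \<open>3 * c\<close> or \<open>3 * c - 2\<close> gives one of \<open>c\<close> that is three
  times better; the exceptional endpoints are carried along by the induction.\<close>

lemma cantor_approach:
  assumes "c \<in> cantor"
  shows "c = 0 \<or> c \<in> snd ` cantor_gaps \<or> (\<exists>c'\<in>cantor. c - 1 / 3 ^ k \<le> c' \<and> c' < c)" (is "?L c k")
    and "c = 1 \<or> c \<in> fst ` cantor_gaps \<or> (\<exists>c'\<in>cantor. c < c' \<and> c' \<le> c + 1 / 3 ^ k)" (is "?R c k")
proof -
  have scale: "z / 3 \<in> fst ` cantor_gaps" "(z + 2) / 3 \<in> fst ` cantor_gaps" if "z \<in> fst ` cantor_gaps" for z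
    using that cantor_gaps_scale(1,2) by force+
  have mid: "1/3 \<in> fst ` cantor_gaps" using cantor_gaps_middle by force
  have R: "?R c k" if "c \<in> cantor" for c k
    using that
  proof (induction k arbitrary: c)
    case 0
    then show ?case using cantor_one cantor_bounds[of c] by force
  next
    case (Suc k)
    obtain z where z: "z \<in> cantor" "c = z / 3 \<or> c = (z + 2) / 3"
      using Suc.prems
    proof (cases rule: cantor_cases)
      case (1 b) then show ?thesis using that by auto
    next
      case (2 b) then show ?thesis using that[of "1 - b"] cantor_flip[of b] by auto
    qed
    have shift: "(x + 2) / 3 \<in> cantor" if "x \<in> cantor" for x
      using cantor_flip_third[OF cantor_flip[OF that]] by (simp add: field_simps)
    from Suc.IH[OF z(1)] show ?case
    proof (elim disjE bexE)
      assume "z = 1" then have "c = 1/3 \<or> c = 1" using z(2) by auto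
      then show ?thesis using mid by blast
    next
      assume "z \<in> fst ` cantor_gaps" then show ?thesis using z(2) scale[of z] by blast
    next
      fix c' assume c': "c' \<in> cantor" "z < c' \<and> c' \<le> z + 1 / 3 ^ k"
      from z(2) show ?thesis
      proof
        assume "c = z / 3"
        then show ?thesis using c' cantor_third[OF c'(1)]
          by (intro disjI2 bexI[of _ "c'/3"]) (auto simp: field_simps)
      next
        assume "c = (z + 2) / 3"
        moreover have "c < (c' + 2) / 3" "(c' + 2) / 3 \<le> c + 1 / 3 ^ k / 3"
          using c' calculation by auto
        ultimately show ?thesis using shift[OF c'(1)]
          by (intro disjI2 bexI[of _ "(c'+2)/3"]) auto
      qed
    qed
  qed
  from R[OF assms] show "?R c k" .
  have "?R (1 - c) k" using R cantor_flip[OF assms] by blast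
  then show "?L c k"
  proof (elim disjE bexE)
    assume "1 - c \<in> fst ` cantor_gaps"
    then have "c \<in> snd ` cantor_gaps" using cantor_gaps_scale(3) by force
    then show ?thesis by simp
  next
    fix c' assume "c' \<in> cantor" "1 - c < c' \<and> c' \<le> 1 - c + 1 / 3 ^ k"
    then show ?thesis using cantor_flip[of c'] by (intro disjI2 bexI[of _ "1 - c'"]) auto
  qed simp
qed

lemma cantor_nonendpoint_approach:
  assumes "c \<in> cantor_nonendpoints" "0 < e"
  shows "\<exists>c'\<in>cantor. c - e < c' \<and> c' < c" "\<exists>c'\<in>cantor. c < c' \<and> c' < c + e"
proof -
  have c: "c \<in> cantor" "c \<noteq> 0" "c \<noteq> 1" "c \<notin> snd ` cantor_gaps" "c \<notin> fst ` cantor_gaps"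
    using assms by (auto simp: cantor_nonendpoints_def)
  obtain k where "1 / (3::real) ^ k < e"
    using real_arch_pow_inv[of e "1/3"] assms by (auto simp: power_divide)
  then show "\<exists>c'\<in>cantor. c - e < c' \<and> c' < c" "\<exists>c'\<in>cantor. c < c' \<and> c' < c + e"
    using cantor_approach[OF c(1), of k] c by fastforce+
qed

section \<open>The jump function and its closed graph\<close>

locale jumps =
  fixes d a :: "nat \<Rightarrow> real"
  assumes d_inj: "inj d"
    and d_nonendpoint: "range d \<subseteq> cantor_nonendpoints"
    and d_dense: "top_of_set cantor closure_of range d = cantor"
    and a_pos: "\<And>n. a n > 0"
    and a_sums: "a sums 1"
begin

abbreviation f :: "real \<Rightarrow> real" where "f \<equiv> jump_fun d a"

definition f_right :: "real \<Rightarrow> real" where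
  "f_right c = (\<Sum>\<^sub>\<infinity>n\<in>{n. d n \<le> c}. a n)"

lemma a_summable: "a summable_on A"
proof -
  have "a summable_on UNIV"
    using a_sums a_pos by (intro norm_summable_imp_summable_on) (auto simp: sums_iff less_imp_le)
  then show ?thesis by (rule summable_on_subset) simp
qed

lemma infsum_UNIV: "(\<Sum>\<^sub>\<infinity>n. a n) = 1"
proof -
  have "(a has_sum (\<Sum>\<^sub>\<infinity>n. a n)) UNIV" using a_summable by simp
  from has_sum_imp_sums[OF this] show ?thesis using a_sums sums_unique2 by blast
qed

lemma infsum_mono_set: "A \<subseteq> B \<Longrightarrow> infsum a A \<le> infsum a B"
  using a_summable a_pos by (intro infsum_mono_neutral) (auto simp: less_imp_le)

lemma f_bounds: "0 \<le> f c" "f c \<le> 1"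
  using infsum_mono_set[of "{}" "{n. d n < c}"] infsum_mono_set[of "{n. d n < c}" UNIV] infsum_UNIV
  by (auto simp: jump_fun_def)

lemma f_le_f_right: "f c \<le> f_right c"
  unfolding jump_fun_def f_right_def by (rule infsum_mono_set) auto

lemma f_right_le_f: "c < c' \<Longrightarrow> f_right c \<le> f c'"
  unfolding jump_fun_def f_right_def by (rule infsum_mono_set) auto

lemma f_mono: "c \<le> c' \<Longrightarrow> f c \<le> f c'"
  unfolding jump_fun_def by (rule infsum_mono_set) auto

lemma f_less_f_right: "f (d n) < f_right (d n)"
proof -
  have "{m. d m \<le> d n} = insert n {m. d m < d n}"
    using d_inj by (auto simp: order_le_less inj_eq)
  then have "f_right (d n) = a n + f (d n)"
    unfolding jump_fun_def f_right_def using a_summable by (simp add: infsum_insert)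
  then show ?thesis using a_pos[of n] by simp
qed

lemma f_right_eq_f: "c \<notin> range d \<Longrightarrow> f_right c = f c"
  unfolding jump_fun_def f_right_def by (rule arg_cong[where f = "infsum a"]) (auto simp: order_le_less)

text \<open>The points \<open>d n\<close> with a large index contribute little, and the finitely many others can
  be kept away from the two sides of \<open>c\<close>; so \<open>f c\<close> and \<open>f_right c\<close> are the one-sided limits
  of \<open>f\<close> at \<open>c\<close>.\<close>

lemma f_one_sided_limits:
  assumes "0 < e"
  obtains r where "0 < r"
    "\<And>x. \<bar>x - c\<bar> < r \<Longrightarrow> x \<le> c \<Longrightarrow> f c - e \<le> f x \<and> f x \<le> f c"
    "\<And>x. \<bar>x - c\<bar> < r \<Longrightarrow> c < x \<Longrightarrow> f_right c \<le> f x \<and> f x \<le> f_right c + e"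
proof -
  have "(\<lambda>N. \<Sum>n<N. a n) \<longlonglongrightarrow> 1" using a_sums by (simp add: sums_def)
  then have "\<forall>\<^sub>F N in sequentially. dist (\<Sum>n<N. a n) 1 < e" using assms tendstoD by blast
  then obtain N where N: "dist (\<Sum>n<N. a n) 1 < e" by (auto simp: eventually_sequentially)
  have "{..<N} \<inter> {N..} = {}" "{..<N} \<union> {N..} = UNIV" by auto
  then have "infsum a UNIV = infsum a {..<N} + infsum a {N..}"
    using infsum_Un_disjoint[of a "{..<N}" "{N..}"] a_summable by simp
  then have tail: "infsum a {N..} \<le> e" using N infsum_UNIV by (simp add: dist_real_def)
  have "finite (d ` {..<N} - {c})" by simp
  from finite_set_avoid[OF this, of c] obtain r where r: "r > 0" "\<And>x. x \<in> d ` {..<N} - {c} \<Longrightarrow> x \<noteq> c \<Longrightarrow> r \<le> dist c x"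
    by blast
  have far: "N \<le> n" if "d n \<noteq> c" "\<bar>d n - c\<bar> < r" for n
    using r(2)[of "d n"] that by (force simp: dist_real_def not_le[symmetric])
  show ?thesis
  proof (rule that[OF r(1)])
    fix x assume x: "\<bar>x - c\<bar> < r" "x \<le> c"
    have "{n. d n < c} = {n. d n < x} \<union> {n. x \<le> d n \<and> d n < c}" using x by auto
    then have "f c = f x + infsum a {n. x \<le> d n \<and> d n < c}"
      unfolding jump_fun_def using a_summable by (simp add: infsum_Un_disjoint disjoint_iff)
    moreover have "infsum a {n. x \<le> d n \<and> d n < c} \<le> infsum a {N..}"
      by (rule infsum_mono_set) (use far x in auto)
    ultimately show "f c - e \<le> f x \<and> f x \<le> f c" using tail f_mono[OF x(2)] by auto
  next
    fix x assume x: "\<bar>x - c\<bar> < r" "c < x"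
    have "{n. d n < x} = {n. d n \<le> c} \<union> {n. c < d n \<and> d n < x}" using x by auto
    then have "f x = f_right c + infsum a {n. c < d n \<and> d n < x}"
      unfolding jump_fun_def f_right_def using a_summable by (simp add: infsum_Un_disjoint disjoint_iff)
    moreover have "infsum a {n. c < d n \<and> d n < x} \<le> infsum a {N..}"
      by (rule infsum_mono_set) (use far x in auto)
    ultimately show "f_right c \<le> f x \<and> f x \<le> f_right c + e" using tail f_right_le_f[OF x(2)] by auto
  qed
qed

abbreviation \<Gamma> :: "real \<Rightarrow> (real \<times> real) set" where
  "\<Gamma> q \<equiv> closure (cantor_graph (\<lambda>c. f c + q))"

lemma Gamma_approach:
  assumes "(c, s) \<in> \<Gamma> q" "0 < e"
  obtains c' where "c' \<in> cantor" "\<bar>c' - c\<bar> < e" "\<bar>f c' + q - s\<bar> < e"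
proof -
  from assms obtain p where p: "p \<in> cantor_graph (\<lambda>c. f c + q)" "dist p (c, s) < e"
    unfolding closure_approachable by blast
  then obtain c' where c': "c' \<in> cantor" "p = (c', f c' + q)" unfolding cantor_graph_def by blast
  have "dist (fst p) (fst (c, s)) < e" "dist (snd p) (snd (c, s)) < e"
    using p(2) dist_fst_le[of p "(c, s)"] dist_snd_le[of p "(c, s)"] by linarith+
  then show ?thesis using that c' by (auto simp: dist_real_def)
qed

lemma Gamma_subset: "\<Gamma> q \<subseteq> cantor \<times> {q..1 + q}"
proof (rule closure_minimal)
  show "cantor_graph (\<lambda>c. f c + q) \<subseteq> cantor \<times> {q..1 + q}"
    using f_bounds by (auto simp: cantor_graph_def)
qed (simp add: closed_Times closed_cantor)

lemma compact_Gamma: "compact (\<Gamma> q)"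
  using compact_Int_closed[OF compact_Times[OF compact_cantor compact_Icc] closed_closure]
    Gamma_subset by (metis inf.absorb_iff2)

text \<open>Near \<open>c\<close> the values of \<open>f\<close> cluster only at the two one-sided limits.\<close>

lemma Gamma_fibre: "(c, s) \<in> \<Gamma> q \<Longrightarrow> s = f c + q \<or> s = f_right c + q"
proof (rule ccontr)
  assume G: "(c, s) \<in> \<Gamma> q" and *: "\<not> (s = f c + q \<or> s = f_right c + q)"
  define e where "e = min \<bar>s - f c - q\<bar> \<bar>s - f_right c - q\<bar> / 2"
  have e: "0 < e" "2 * e \<le> \<bar>s - f c - q\<bar>" "2 * e \<le> \<bar>s - f_right c - q\<bar>" using * unfolding e_def by auto
  obtain r where r: "0 < r"
    "\<And>x. \<bar>x - c\<bar> < r \<Longrightarrow> x \<le> c \<Longrightarrow> f c - e \<le> f x \<and> f x \<le> f c"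
    "\<And>x. \<bar>x - c\<bar> < r \<Longrightarrow> c < x \<Longrightarrow> f_right c \<le> f x \<and> f x \<le> f_right c + e"
    using f_one_sided_limits[OF e(1)] by blast
  obtain c' where c': "\<bar>c' - c\<bar> < min r e" "\<bar>f c' + q - s\<bar> < min r e"
    using Gamma_approach[OF G, of "min r e"] r(1) e(1) by auto
  show False
  proof (cases "c' \<le> c")
    case True then show ?thesis using r(2)[of c'] c' e by linarith
  next
    case False then show ?thesis using r(3)[of c'] c' e by linarith
  qed
qed

text \<open>At a point that is not a jump point \<open>f\<close> is continuous, so the density of the jump points in
  the Cantor set puts the graph over them close to every point of \<open>\<Gamma> q\<close>.\<close>

lemma Gamma_near_jump:
  assumes "(c, s) \<in> \<Gamma> q" "0 < e"
  obtains n where "\<bar>d n - c\<bar> < e" "\<bar>f (d n) + q - s\<bar> < e"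
proof -
  obtain c' where c': "c' \<in> cantor" "\<bar>c' - c\<bar> < e/2" "\<bar>f c' + q - s\<bar> < e/2"
    using Gamma_approach[OF assms(1), of "e/2"] assms(2) by auto
  show ?thesis
  proof (cases "c' \<in> range d")
    case True then show ?thesis using that c' by (metis (no_types, opaque_lifting) assms(2) field_sum_of_halves less_add_same_cancel1 half_gt_zero less_trans rangeE)
  next
    case False
    obtain r where r: "0 < r"
      "\<And>x. \<bar>x - c'\<bar> < r \<Longrightarrow> x \<le> c' \<Longrightarrow> f c' - e/2 \<le> f x \<and> f x \<le> f c'"
      "\<And>x. \<bar>x - c'\<bar> < r \<Longrightarrow> c' < x \<Longrightarrow> f_right c' \<le> f x \<and> f x \<le> f_right c' + e/2"
      using f_one_sided_limits[of "e/2" c'] assms(2) by auto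
    have "c' \<in> closure (range d)"
      using d_dense c'(1) closure_mono[of "cantor \<inter> range d" "range d"]
      by (auto simp: closure_of_subtopology)
    then obtain n where n: "\<bar>d n - c'\<bar> < min r (e/2)"
      using r(1) assms(2) unfolding closure_approachable by (auto simp: dist_real_def dest!: spec[of _ "min r (e/2)"])
    have "\<bar>f (d n) - f c'\<bar> \<le> e/2"
      using r(2,3)[of "d n"] n f_right_eq_f[OF False] by (cases "d n \<le> c'") auto
    then show ?thesis using that[of n] n c' by linarith
  qed
qed

end

section \<open>The charts of the bucket-handle continuum\<close>

text \<open>The two diagonal points joined by the arc of index \<open>i\<close> and parameter \<open>c\<close>.\<close>

definition foot :: "nat \<Rightarrow> real \<Rightarrow> real" where
  "foot i c = (if i = 0 then c / 3 else 2 / 3 ^ i + c / 3 ^ (i + 1))"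

definition head :: "nat \<Rightarrow> real \<Rightarrow> real" where
  "head i c = (if i = 0 then 1 - c / 3 else 5 / 3 ^ i - foot i c)"

lemma foot_head_simps:
  "foot 0 c = c / 3" "head 0 c = 1 - c / 3"
  "foot (Suc i) c = (1 - (1 - c / 3) / 3) / 3 ^ i" "head (Suc i) c = (1 - (c / 3) / 3) / 3 ^ i"
  by (auto simp: foot_def head_def field_simps)

lemma cantor_power: "x \<in> cantor \<Longrightarrow> x / 3 ^ i \<in> cantor"
proof (induction i)
  case (Suc i)
  then show ?case using cantor_third[of "x / 3 ^ i"] by (simp add: mult.commute)
qed simp

lemma foot_head_cantor:
  assumes "c \<in> cantor"
  shows "foot i c \<in> cantor" "head i c \<in> cantor"
proof -
  have c: "1 - (1 - c / 3) / 3 \<in> cantor" "1 - (c / 3) / 3 \<in> cantor"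
    using cantor_flip_third[OF cantor_flip_third[OF assms]] cantor_flip_third[OF cantor_third[OF assms]]
    by blast+
  show "foot i c \<in> cantor"
    by (cases i) (use cantor_third[OF assms] cantor_power[OF c(1)] in \<open>auto simp only: foot_head_simps\<close>)
  show "head i c \<in> cantor"
    by (cases i) (use cantor_flip_third[OF assms] cantor_power[OF c(2)] in \<open>auto simp only: foot_head_simps\<close>)
qed

text \<open>Multiplication by 3 shifts the index of a lower arc by one, and the points of the right third of
  the Cantor set are the ends of the arcs of index 1.\<close>

lemma foot_head_exhaust:
  assumes "z \<in> cantor" "z \<noteq> 0"
  obtains i c where "0 < i" "c \<in> cantor" "z = foot i c \<or> z = head i c"
proof -
  have "0 < z" using assms cantor_bounds[of z] by auto
  then obtain k where "1 / (3::real) ^ k < z"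
    using real_arch_pow_inv[of z "1/3"] assms by (auto simp: power_divide)
  then have "1 / 3 ^ k \<le> z" by simp
  then have "\<exists>i>0. \<exists>c\<in>cantor. z = foot i c \<or> z = head i c" using assms(1)
  proof (induction k arbitrary: z)
    have high: "\<exists>i>0. \<exists>c\<in>cantor. z = foot i c \<or> z = head i c" if b: "z = 1 - b / 3" "b \<in> cantor" for z b
      using b(2)
    proof (cases rule: cantor_cases)
      case (1 b')
      then have "z = head (Suc 0) b'" using b by (simp add: foot_head_simps)
      then show ?thesis using 1 by blast
    next
      case (2 b')
      then have "z = foot (Suc 0) b'" using b by (simp add: foot_head_simps)
      then show ?thesis using 2 by blast
    qed
    { case 0
      then have "z = 1 - 0 / 3" using cantor_bounds[of z] by auto
      then show ?case using high cantor_zero by blast }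
    { case (Suc k)
      from Suc.prems(2) show ?case
      proof (cases rule: cantor_cases)
        case (1 b)
        then have "1 / 3 ^ k \<le> b" using Suc.prems(1) by simp
        then obtain i c where ic: "i > 0" "c \<in> cantor" "b = foot i c \<or> b = head i c"
          using Suc.IH[of b] 1 by blast
        then obtain j where j: "i = Suc j" by (cases i) auto
        have "z = foot (Suc i) c \<or> z = head (Suc i) c" using ic(3)
        proof
          assume "b = foot i c"
          then show ?thesis using 1(2) by (simp add: j foot_head_simps)
        next
          assume "b = head i c"
          then show ?thesis using 1(2) by (simp add: j foot_head_simps)
        qed
        then show ?thesis using ic(2) by blast
      next
        case (2 b)
        then show ?thesis using high by blast
      qed }
  qed
  then show ?thesis using that by blast
qed

lemma foot_head_bounds:
  assumes "c \<in> cantor"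
  shows "foot i c < head i c" "i \<noteq> 0 \<Longrightarrow> 2 / 3 ^ i \<le> foot i c" "head i c \<le> 3 / 3 ^ i"
    "0 \<le> foot i c"
    "i \<noteq> 0 \<Longrightarrow> foot i c + head i c = 5 / 3 ^ i" "i = 0 \<Longrightarrow> foot i c + head i c = 1"
proof -
  define s :: real where "s = 1 / 3 ^ i"
  have s: "0 < s" by (simp add: s_def)
  have c: "0 \<le> c * s" "c * s \<le> s" using cantor_bounds[OF assms] s by auto
  have f: "foot i c = (if i = 0 then c / 3 else 2 * s + c * s / 3)"
    and h: "head i c = (if i = 0 then 1 - c / 3 else 3 * s - c * s / 3)"
    by (auto simp: foot_def head_def s_def)
  show "foot i c < head i c" "0 \<le> foot i c" using f h c s cantor_bounds[OF assms] by auto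
  have "2 * s = 2 / 3 ^ i" "3 * s = 3 / 3 ^ i" "5 * s = 5 / 3 ^ i" by (auto simp: s_def)
  then show "i \<noteq> 0 \<Longrightarrow> 2 / 3 ^ i \<le> foot i c" "head i c \<le> 3 / 3 ^ i"
    "i \<noteq> 0 \<Longrightarrow> foot i c + head i c = 5 / 3 ^ i" "i = 0 \<Longrightarrow> foot i c + head i c = 1"
    using f h c s cantor_bounds[OF assms] by (auto simp: s_def split: if_splits)
qed

lemma foot_inj: "foot i c = foot i c' \<longleftrightarrow> c = c'"
  by (cases i) (auto simp: foot_head_simps)

text \<open>The lower arcs of index \<open>i\<close> have their larger coordinate in \<open>{2 / 3 ^ i..3 / 3 ^ i}\<close>; these
  ranges are disjoint for different indices.\<close>

lemma ternary_scales_disjoint: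
  assumes "m < n" shows "(3::real) / 3 ^ n < 2 / 3 ^ m"
proof -
  have "(3::real) * 3 ^ m \<le> 3 ^ n" using power_increasing[of "Suc m" n "3::real"] assms by simp
  also have "\<dots> < 2 * 3 ^ n" by simp
  finally show ?thesis by (simp add: field_simps)
qed

lemma foot_head_same_arc:
  assumes "c \<in> cantor" "c' \<in> cantor" "0 < i" "0 < j"
  shows "foot i c = foot j c' \<Longrightarrow> i = j \<and> c = c'" "head i c = head j c' \<Longrightarrow> i = j \<and> c = c'"
    "foot i c \<noteq> head j c'"
proof -
  have *: "2 / 3 ^ i \<le> foot i c" "foot i c < head i c" "head i c \<le> 3 / 3 ^ i"
    "2 / 3 ^ j \<le> foot j c'" "foot j c' < head j c'" "head j c' \<le> 3 / 3 ^ j"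
    using foot_head_bounds assms by auto
  note less = ternary_scales_disjoint
  have ij: "i = j" if "2 / 3 ^ i \<le> z" "z \<le> 3 / 3 ^ i" "2 / 3 ^ j \<le> z" "z \<le> (3::real) / 3 ^ j" for z
    using less[of i j] less[of j i] that by (cases i j rule: linorder_cases) linarith+
  show "i = j \<and> c = c'" if "foot i c = foot j c'"
    using ij[of "foot i c"] * that foot_inj by auto
  show "i = j \<and> c = c'" if "head i c = head j c'"
  proof -
    have "i = j" using ij[of "head i c"] * that by auto
    then show ?thesis using that foot_inj by (auto simp: head_def split: if_splits)
  qed
  show "foot i c \<noteq> head j c'"
  proof
    assume eq: "foot i c = head j c'"
    then have "i = j" using ij[of "foot i c"] * by auto
    then obtain k where k: "i = Suc k" "j = Suc k" using assms by (cases i) auto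
    show False using eq cantor_bounds[OF assms(1)] cantor_bounds[OF assms(2)] by (auto simp: k foot_head_simps)
  qed
qed

text \<open>Writing the two legs of an L-shaped arc with clipped coordinates removes the case
  distinction and makes continuity evident.\<close>

lemma chart_clipped:
  assumes "c \<in> cantor"
  shows "knaster_chart i (c, t) =
    (let x = foot i c; y = head i c; u = min (x + 2 * t * (y - x)) y; v = max x (x + (2 * t - 1) * (y - x))
     in if i = 0 then (v, u) else (u, v))"
proof -
  define x where "x = foot i c"
  define y where "y = head i c"
  have xy: "x < y" using foot_head_bounds[OF assms] by (simp add: x_def y_def)
  have def: "knaster_chart i (c, t) = (let u = (if t \<le> 1/2 then x + 2 * t * (y - x) else y);
      v = (if t \<le> 1/2 then x else x + (2 * t - 1) * (y - x)) in if i = 0 then (v, u) else (u, v))"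
    by (simp add: knaster_chart_def x_def y_def foot_def head_def Let_def)
  have u: "(if t \<le> 1/2 then x + 2 * t * (y - x) else y) = min (x + 2 * t * (y - x)) y"
  proof (cases "t \<le> 1/2")
    case True
    then have "2 * t * (y - x) \<le> 1 * (y - x)" using xy by (intro mult_right_mono) auto
    then show ?thesis using True by (simp add: min_def)
  next
    case False
    then have "1 * (y - x) \<le> 2 * t * (y - x)" using xy by (intro mult_right_mono) auto
    then show ?thesis using False by (simp add: min_def)
  qed
  have v: "(if t \<le> 1/2 then x else x + (2 * t - 1) * (y - x)) = max x (x + (2 * t - 1) * (y - x))"
    using xy by (auto simp: max_def zero_le_mult_iff mult_le_0_iff)
  show ?thesis unfolding def u v by (simp add: Let_def x_def y_def)
qed

lemma chart_continuous: "continuous_on (cantor \<times> UNIV) (knaster_chart i)"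
proof -
  have "continuous_on (cantor \<times> UNIV) (\<lambda>p.
    (let x = foot i (fst p); y = head i (fst p); u = min (x + 2 * (snd p) * (y - x)) y;
       v = max x (x + (2 * (snd p) - 1) * (y - x)) in if i = 0 then (v, u) else (u, v)))"
    unfolding Let_def foot_def head_def by (cases "i = 0") (auto intro!: continuous_intros)
  then show ?thesis
    by (rule continuous_on_cong[THEN iffD1, rotated -1]) (auto simp: chart_clipped)
qed

lemma chart_ends:
  assumes "c \<in> cantor"
  shows "knaster_chart i (c, 0) = (foot i c, foot i c)" "knaster_chart i (c, 1) = (head i c, head i c)"
  using foot_head_bounds(1)[OF assms, of i] assms by (auto simp: chart_clipped Let_def)

text \<open>The sum of the coordinates grows linearly along both legs, and the foot is the minimum of two
  expressions in the coordinates, one of which is constant on each leg. So both parameters can be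
  read off from the point.\<close>

lemma chart_coordinates:
  fixes i :: nat
  assumes "c \<in> cantor" "t \<in> {0..1}"
  defines "p \<equiv> knaster_chart i (c, t)"
  shows "fst p + snd p = 2 * foot i c + 2 * t * (head i c - foot i c)"
    and "foot i c \<le> fst p" "foot i c \<le> snd p" "fst p \<le> head i c" "snd p \<le> head i c"
    and "i \<noteq> 0 \<Longrightarrow> snd p \<le> fst p" "i = 0 \<Longrightarrow> fst p \<le> snd p"
    and "0 < t \<Longrightarrow> t < 1 \<Longrightarrow> fst p \<noteq> snd p"
    and "i \<noteq> 0 \<Longrightarrow> foot i c = min (snd p) (5 / 3 ^ i - fst p)" "i = 0 \<Longrightarrow> foot i c = min (fst p) (1 - snd p)"
proof -
  define x where "x = foot i c"
  define w where "w = head i c - foot i c"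
  have w: "w > 0" using foot_head_bounds(1)[OF assms(1), of i] by (simp add: w_def)
  have y: "head i c = x + w" by (simp add: x_def w_def)
  define u where "u = min (2 * t * w) w"
  define v where "v = max 0 ((2 * t - 1) * w)"
  have p: "p = (if i = 0 then (x + v, x + u) else (x + u, x + v))"
  proof -
    have "head i c = x + w" "foot i c = x" by (simp_all add: y x_def)
    then show ?thesis unfolding p_def chart_clipped[OF assms(1)] Let_def
      by (auto simp: u_def v_def min_def max_def)
  qed
  have tw: "0 \<le> t * w" "t * w \<le> w" using w assms(2) by auto
  have uv: "u + v = 2 * t * w" "0 \<le> v" "v \<le> u" "u \<le> w" "v = 0 \<or> u = w"
    using tw assms(2) by (auto simp: u_def v_def min_def max_def algebra_simps)
  have strict: "v < u" if "0 < t" "t < 1"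
  proof -
    have "0 < t * w" "t * w < w" using that w by auto
    then show ?thesis using that by (auto simp: u_def v_def min_def max_def algebra_simps)
  qed
  show "fst p + snd p = 2 * foot i c + 2 * t * (head i c - foot i c)"
    using uv(1) unfolding p by (auto simp: x_def w_def)
  show "foot i c \<le> fst p" "foot i c \<le> snd p" "fst p \<le> head i c" "snd p \<le> head i c"
    "i \<noteq> 0 \<Longrightarrow> snd p \<le> fst p" "i = 0 \<Longrightarrow> fst p \<le> snd p"
    using uv unfolding y p by (auto simp: x_def[symmetric])
  show "0 < t \<Longrightarrow> t < 1 \<Longrightarrow> fst p \<noteq> snd p" using strict unfolding p by auto
  show "foot i c = min (snd p) (5 / 3 ^ i - fst p)" if "i \<noteq> 0"
  proof -
    have "x + (x + w) = 5 / 3 ^ i" using foot_head_bounds(5)[OF assms(1) that] unfolding y x_def .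
    moreover have "p = (x + u, x + v)" using p that by simp
    ultimately show ?thesis using uv unfolding x_def[symmetric] by (auto simp: min_def)
  qed
  show "foot i c = min (fst p) (1 - snd p)" if "i = 0"
  proof -
    have "x + (x + w) = 1" using foot_head_bounds(6)[OF assms(1) that] unfolding y x_def .
    moreover have "p = (x + v, x + u)" using p that by simp
    ultimately show ?thesis using uv unfolding x_def[symmetric] by (auto simp: min_def)
  qed
qed

lemma chart_inj:
  assumes "c \<in> cantor" "t \<in> {0..1}" "c' \<in> cantor" "t' \<in> {0..1}"
    and eq: "knaster_chart i (c, t) = knaster_chart i (c', t')"
  shows "c = c'" "t = t'"
proof -
  have "foot i c = foot i c'"
  proof (cases "i = 0")
    case True
    show ?thesis
      using chart_coordinates(10)[OF assms(1,2) True] chart_coordinates(10)[OF assms(3,4) True]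
      unfolding eq by (rule trans[OF _ sym])
  next
    case False
    show ?thesis
      using chart_coordinates(9)[OF assms(1,2) False] chart_coordinates(9)[OF assms(3,4) False]
      unfolding eq by (rule trans[OF _ sym])
  qed
  then show c: "c = c'" by (simp only: foot_inj)
  have "2 * foot i c' + 2 * t * (head i c' - foot i c') = 2 * foot i c' + 2 * t' * (head i c' - foot i c')"
    using chart_coordinates(1)[OF assms(1,2), of i] chart_coordinates(1)[OF assms(3,4), of i]
    unfolding eq unfolding c by (rule trans[OF sym])
  then show "t = t'" using foot_head_bounds(1)[OF assms(3), of i] by simp
qed

lemma chart_disjoint:
  assumes "c \<in> cantor" "t \<in> {0<..<1}" "c' \<in> cantor" "t' \<in> {0..1}" "i \<noteq> j"
  shows "knaster_chart i (c, t) \<noteq> knaster_chart j (c', t')"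
proof
  assume eq: "knaster_chart i (c, t) = knaster_chart j (c', t')"
  have t: "t \<in> {0..1}" using assms(2) by auto
  note P = chart_coordinates[OF assms(1) t, of i] and Q = chart_coordinates[OF assms(3,4), of j]
  show False
  proof (cases "i = 0 \<or> j = 0")
    case True
    then show False using P(6,7,8) Q(6,7) assms(2,5) eq by auto
  next
    case False
    have "fst (knaster_chart i (c, t)) \<in> {2 / 3 ^ i..3 / 3 ^ i}"
      "fst (knaster_chart i (c, t)) \<in> {2 / 3 ^ j..3 / 3 ^ j}"
      using P(2,4) Q(2,4) foot_head_bounds(2,3)[OF assms(1), of i] foot_head_bounds(2,3)[OF assms(3), of j] False eq
      by auto
    then show False using ternary_scales_disjoint[of i j] ternary_scales_disjoint[of j i] assms(5)
      by (cases i j rule: linorder_cases) auto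
  qed
qed

text \<open>The arcs accumulate only at the origin, so an infinite union of closed sets of arcs is
  closed once the origin is added.\<close>

lemma closed_shrinking_union:
  fixes E :: "nat \<Rightarrow> 'a::metric_space set"
  assumes closed: "\<And>i. i \<in> I \<Longrightarrow> closed (E i)"
    and small: "\<And>i. i \<in> I \<Longrightarrow> E i \<subseteq> cball z (k / 3 ^ i)"
  shows "closed ({z} \<union> (\<Union>i\<in>I. E i))"
proof -
  have "p \<in> {z} \<union> (\<Union>i\<in>I. E i)" if p: "p \<in> closure ({z} \<union> (\<Union>i\<in>I. E i))" for p
  proof (cases "p = z")
    case False
    define r where "r = dist z p / 2"
    have r: "r > 0" using False by (simp add: r_def)
    have "(\<lambda>i. k / 3 ^ i) \<longlonglongrightarrow> 0"
      using tendsto_mult_right_zero[OF LIMSEQ_power_zero[of "1/3 :: real"], of k]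
      by (simp add: power_divide)
    then have "\<forall>\<^sub>F i in sequentially. k / 3 ^ i < r" using r by (rule order_tendstoD)
    then obtain N where N: "\<And>i. i \<ge> N \<Longrightarrow> k / 3 ^ i < r" by (auto simp: eventually_sequentially)
    define H where "H = cball z r \<union> (\<Union>i\<in>I \<inter> {..<N}. E i)"
    have "closed H" unfolding H_def using closed by (intro closed_Un closed_cball closed_UN) auto
    moreover have "{z} \<union> (\<Union>i\<in>I. E i) \<subseteq> H"
    proof -
      have "E i \<subseteq> H" if "i \<in> I" for i
      proof (cases "i < N")
        case True then show ?thesis using that by (auto simp: H_def)
      next
        case False then show ?thesis using small[OF that] N[of i] by (force simp: H_def)
      qed
      then show ?thesis using r by (auto simp: H_def)
    qed
    ultimately have "p \<in> H" using p closure_minimal by blast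
    then show ?thesis using False by (auto simp: H_def r_def)
  qed simp
  then show ?thesis using closure_subset_eq by blast
qed

abbreviation arcs :: "nat \<Rightarrow> (real \<times> real) set" where
  "arcs i \<equiv> knaster_chart i ` (cantor \<times> {0..1})"

lemma compact_chart_image: "compact T \<Longrightarrow> T \<subseteq> cantor \<times> UNIV \<Longrightarrow> compact (knaster_chart i ` T)"
  using chart_continuous compact_continuous_image continuous_on_subset by blast

lemma compact_arcs: "compact (arcs i)"
  by (intro compact_chart_image compact_Times compact_cantor compact_Icc) auto

lemma arcs_small: "arcs i \<subseteq> cball (0, 0) (6 / 3 ^ i)"
proof
  fix p assume "p \<in> arcs i"
  then obtain c t where ct: "c \<in> cantor" "t \<in> {0..1}" "p = knaster_chart i (c, t)" by auto
  have "\<bar>fst p\<bar> \<le> 3 / 3 ^ i" "\<bar>snd p\<bar> \<le> 3 / 3 ^ i"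
    using chart_coordinates(2-5)[OF ct(1,2), of i] foot_head_bounds(3,4)[OF ct(1), of i] ct(3) by auto
  moreover have "norm p \<le> \<bar>fst p\<bar> + \<bar>snd p\<bar>" using norm_Pair_le[of "fst p" "snd p"] by simp
  ultimately show "p \<in> cball (0, 0) (6 / 3 ^ i)" by (simp add: zero_prod_def[symmetric])
qed

lemma closed_arcs_family: "closed ({(0, 0)} \<union> (\<Union>i\<in>I. arcs i))"
  by (rule closed_shrinking_union[OF compact_imp_closed[OF compact_arcs] arcs_small])

lemma knaster_eq: "knaster = {(0, 0)} \<union> (\<Union>i. arcs i)"
proof
  have "knaster_diagonal \<subseteq> {(0, 0)} \<union> (\<Union>i. arcs i)"
  proof
    fix p assume "p \<in> knaster_diagonal"
    then obtain z where z: "z \<in> cantor" "p = (z, z)" by (auto simp: knaster_diagonal_def)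
    show "p \<in> {(0, 0)} \<union> (\<Union>i. arcs i)"
    proof (cases "z = 0")
      case False
      from foot_head_exhaust[OF z(1) this] obtain i c where "c \<in> cantor" "z = foot i c \<or> z = head i c" by blast
      then have "p = knaster_chart i (c, 0) \<or> p = knaster_chart i (c, 1)" using z by (auto simp: chart_ends)
      then have "p \<in> arcs i" using \<open>c \<in> cantor\<close> by auto
      then show ?thesis by blast
    qed (use z in auto)
  qed
  then show "knaster \<subseteq> {(0, 0)} \<union> (\<Union>i. arcs i)" unfolding knaster_def by force
  show "{(0, 0)} \<union> (\<Union>i. arcs i) \<subseteq> knaster"
  proof -
    have "knaster_chart i (c, t) \<in> knaster" if "c \<in> cantor" "t \<in> {0..1}" for i c t
    proof (cases "t = 0 \<or> t = 1")
      case True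
      then show ?thesis using that chart_ends[OF that(1), of i] foot_head_cantor[OF that(1), of i]
        by (auto simp: knaster_def knaster_diagonal_def)
    next
      case False
      then show ?thesis using that unfolding knaster_def by force
    qed
    moreover have "(0, 0) \<in> knaster" using cantor_zero by (auto simp: knaster_def knaster_diagonal_def)
    ultimately show ?thesis by auto
  qed
qed

lemma compact_knaster: "compact knaster"
proof -
  have "arcs i \<subseteq> cball (0, 0) 6" for i
  proof -
    have "(6::real) / 3 ^ i \<le> 6" by (simp add: divide_le_eq)
    then show ?thesis by (rule subset_trans[OF arcs_small subset_cball])
  qed
  then have "knaster \<subseteq> cball (0, 0) 6" unfolding knaster_eq
    by (intro Un_least UN_least) auto
  then have "bounded knaster" using bounded_cball bounded_subset by metis
  moreover have "closed knaster" unfolding knaster_eq by (rule closed_arcs_family)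
  ultimately show ?thesis unfolding compact_eq_bounded_closed by simp
qed

lemma chart_off_diagonal:
  "c \<in> cantor \<Longrightarrow> t \<in> {0<..<1} \<Longrightarrow> knaster_chart i (c, t) \<notin> knaster_diagonal"
  using chart_coordinates(8)[of c t i] by (auto simp: knaster_diagonal_def)

text \<open>The complement consists of a compact part of the \<open>i\<close>-th family of arcs and of all other families,
  which shrink towards the origin.\<close>

lemma chart_open:
  assumes "open U"
  shows "closed (knaster - knaster_chart i ` (U \<inter> cantor \<times> {0<..<1}))"
proof -
  define V where "V = knaster_chart i ` (U \<inter> cantor \<times> {0<..<1})"
  define T where "T = cantor \<times> {0..1} - U \<inter> (UNIV \<times> {0<..<1::real})"
  define B where "B = {(0, 0)} \<union> (\<Union>j\<in>-{i}. arcs j)"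
  have "p \<in> knaster_chart i ` T \<union> B" if pV: "p \<in> knaster - V" for p
  proof (rule UnCI)
    assume "p \<notin> B"
    then have "p \<noteq> (0, 0)" "p \<notin> arcs j" if "j \<noteq> i" for j using that by (auto simp: B_def)
    moreover obtain j where j: "p = (0, 0) \<or> p \<in> arcs j" using pV by (auto simp: knaster_eq)
    moreover have "p \<noteq> (0, 0)" using \<open>p \<notin> B\<close> by (auto simp: B_def)
    ultimately have "p \<in> arcs i" by metis
    then obtain x where x: "x \<in> cantor \<times> {0..1}" "p = knaster_chart i x" by (rule imageE)
    have "x \<in> T"
    proof (rule ccontr)
      assume "x \<notin> T"
      then have "x \<in> U \<inter> cantor \<times> {0<..<1}" using x(1) by (auto simp: T_def)
      then have "p \<in> V" unfolding V_def using x(2) by (rule rev_image_eqI)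
      then show False using pV by simp
    qed
    then show "p \<in> knaster_chart i ` T" using x(2) by (rule rev_image_eqI)
  qed
  moreover have "p \<in> knaster - V" if p: "p \<in> knaster_chart i ` T \<union> B" for p
  proof
    have "knaster_chart i ` T \<subseteq> arcs i" by (rule image_mono) (auto simp: T_def)
    then show "p \<in> knaster" using p by (auto simp: knaster_eq B_def simp del: image_subset_iff)
    show "p \<notin> V"
    proof
      assume "p \<in> V"
      then obtain c t where ct: "c \<in> cantor" "t \<in> {0<..<1}" "(c, t) \<in> U" "p = knaster_chart i (c, t)"
        unfolding V_def by auto
      have t: "t \<in> {0..1}" using ct(2) by simp
      from p consider "p \<in> knaster_chart i ` T" | "p = (0, 0)" | j where "j \<noteq> i" "p \<in> arcs j"
        by (auto simp: B_def)
      then show False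
      proof cases
        case 1
        then obtain c' t' where ct': "c' \<in> cantor" "t' \<in> {0..1}" "(c', t') \<notin> U \<inter> (UNIV \<times> {0<..<1})"
          "p = knaster_chart i (c', t')" unfolding T_def by (elim imageE DiffE SigmaE) auto
        from chart_inj[OF ct(1) t ct'(1,2)] have "c = c'" "t = t'" using ct(4) ct'(4) by metis+
        then show False using ct(2,3) ct'(3) by simp
      next
        case 2
        then have "p \<in> knaster_diagonal" using cantor_zero by (simp add: knaster_diagonal_def)
        then show False using chart_off_diagonal[OF ct(1,2)] ct(4) by metis
      next
        case 3
        then obtain c' t' where "c' \<in> cantor" "t' \<in> {0..1}" "p = knaster_chart j (c', t')" by auto
        then show False using chart_disjoint[OF ct(1,2), of c' t' i j] ct(4) 3(1) by auto
      qed
    qed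
  qed
  ultimately have "knaster - V = knaster_chart i ` T \<union> B" by (intro equalityI subsetI)
  moreover have "compact T" unfolding T_def
    by (intro compact_diff compact_Times compact_cantor compact_Icc open_Int assms open_Times) auto
  then have "closed (knaster_chart i ` T)"
    by (intro compact_imp_closed compact_chart_image) (auto simp: T_def)
  ultimately show ?thesis using closed_Un closed_arcs_family[of "-{i}"]
    unfolding V_def[symmetric] B_def[symmetric] by simp
qed

section \<open>Long arcs\<close>

text \<open>A long arc of level \<open>n + 1\<close> traverses a level \<open>n\<close> arc, crosses over along an arc of index
  \<open>n + 1\<close>, and returns along a second level \<open>n\<close> arc.\<close>

fun long_arc :: "nat \<Rightarrow> real \<times> real \<Rightarrow> real \<times> real" where
  "long_arc 0 (c, t) = knaster_chart 0 (c, t)"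
| "long_arc (Suc n) (c, t) =
    (if t \<le> 1/3 then long_arc n (c / 3, 3 * t)
     else if t \<le> 2/3 then knaster_chart (Suc n) (c, 2 - 3 * t)
     else long_arc n (1 - c / 3, 3 - 3 * t))"

text \<open>Outside this small set at the origin the continuum is a product of the Cantor set with
  an open arc, parametrized by \<open>long_arc n\<close>.\<close>

definition core :: "nat \<Rightarrow> (real \<times> real) set" where
  "core n = {(0, 0)} \<union> (\<Union>i\<in>{n<..}. arcs i)"

lemma core_Suc: "core n = arcs (Suc n) \<union> core (Suc n)"
proof -
  have "{n<..} = insert (Suc n) {Suc n<..}" by auto
  then show ?thesis unfolding core_def by auto
qed

lemma closed_core: "closed (core n)"
  unfolding core_def by (rule closed_arcs_family)

lemma core_subset_knaster: "core n \<subseteq> knaster"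
  unfolding core_def knaster_eq by auto

lemma core_small: "core n \<subseteq> cball (0, 0) (6 / 3 ^ n)"
proof -
  have "arcs i \<subseteq> cball (0, 0) (6 / 3 ^ n)" if "i \<in> {n<..}" for i
  proof -
    have "(6::real) / 3 ^ i \<le> 6 / 3 ^ n" using that by (intro divide_left_mono power_increasing) auto
    then show ?thesis by (rule subset_trans[OF arcs_small subset_cball])
  qed
  then show ?thesis unfolding core_def by (intro Un_least UN_least) auto
qed

lemma core_diagonal:
  assumes "z \<in> cantor" "z \<le> 1 / 3 ^ n"
  shows "(z, z) \<in> core n"
proof (cases "z = 0")
  case True then show ?thesis by (simp add: core_def)
next
  case False
  from foot_head_exhaust[OF assms(1) this] obtain i c where ic: "0 < i" "c \<in> cantor" "z = foot i c \<or> z = head i c"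
    by blast
  have "n < i"
  proof (rule ccontr)
    assume "\<not> n < i"
    then have "(2::real) / 3 ^ n \<le> 2 / 3 ^ i" by (intro divide_left_mono power_increasing) auto
    also have "2 / 3 ^ i \<le> z" using foot_head_bounds(1,2)[OF ic(2), of i] ic(1,3) by auto
    finally have "(2::real) / 3 ^ n \<le> 1 / 3 ^ n" using assms(2) by linarith
    then show False by (simp add: divide_le_cancel)
  qed
  moreover have "(z, z) \<in> arcs i"
    using ic(3) chart_ends[OF ic(2), of i] ic(2) by (metis atLeastAtMost_iff image_eqI mem_Sigma_iff order_refl zero_le_one)
  ultimately show ?thesis unfolding core_def by blast
qed

lemma long_arc_ends:
  assumes "c \<in> cantor"
  shows "long_arc n (c, 0) = (c / 3 ^ Suc n, c / 3 ^ Suc n)"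
    "long_arc n (c, 1) = (1 / 3 ^ n - c / 3 ^ Suc n, 1 / 3 ^ n - c / 3 ^ Suc n)"
  using assms
proof (induction n arbitrary: c)
  case 0
  { case 1 then show ?case by (simp add: chart_ends foot_def) }
  { case 2 then show ?case by (simp add: chart_ends head_def) }
next
  case (Suc n)
  { case 1 then show ?case using Suc.IH(1)[OF cantor_third] by simp }
  { case 2 then show ?case using Suc.IH(1)[OF cantor_flip_third] by (simp add: diff_divide_distrib) }
qed

lemma long_arc_ends_core:
  assumes "c \<in> cantor"
  shows "long_arc n (c, 0) \<in> core n" "long_arc n (c, 1) \<in> core n"
    "1 / 3 ^ n - c / 3 ^ Suc n \<in> cantor"
proof -
  have "1 / 3 ^ n - c / 3 ^ Suc n = (1 - c / 3) / 3 ^ n" by (simp add: diff_divide_distrib)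
  then show z: "1 / 3 ^ n - c / 3 ^ Suc n \<in> cantor" using cantor_power[OF cantor_flip_third[OF assms]] by simp
  show "long_arc n (c, 0) \<in> core n" unfolding long_arc_ends[OF assms]
    using cantor_power[OF assms, of "Suc n"] cantor_bounds[OF assms]
    by (intro core_diagonal) (auto simp: field_simps)
  show "long_arc n (c, 1) \<in> core n" unfolding long_arc_ends[OF assms]
    using z cantor_bounds[OF assms] by (intro core_diagonal) auto
qed

lemma long_arc_joints:
  assumes "c \<in> cantor"
  shows "long_arc n (c / 3, 1) = knaster_chart (Suc n) (c, 1)"
    "long_arc n (1 - c / 3, 1) = knaster_chart (Suc n) (c, 0)"
  unfolding chart_ends[OF assms] long_arc_ends[OF cantor_third[OF assms]] long_arc_ends[OF cantor_flip_third[OF assms]]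
  by (simp_all add: foot_def head_def diff_divide_distrib)

lemma long_arc_continuous: "continuous_on (cantor \<times> {0..1}) (long_arc n)"
proof (induction n)
  case 0
  have "continuous_on (cantor \<times> {0..1}) (knaster_chart 0)"
    by (rule continuous_on_subset[OF chart_continuous]) auto
  moreover have "long_arc 0 = knaster_chart 0" by auto
  ultimately show ?case by simp
next
  case (Suc n)
  let ?S = "cantor \<times> {0..1::real}"
  have eq: "long_arc (Suc n) = (\<lambda>p. if snd p \<le> 1/3 then long_arc n (fst p / 3, 3 * snd p)
     else if snd p \<le> 2/3 then knaster_chart (Suc n) (fst p, 2 - 3 * snd p)
     else long_arc n (1 - fst p / 3, 3 - 3 * snd p))" by (rule ext) (auto simp: split_paired_all)
  show ?case unfolding eq
  proof (intro continuous_on_cases_le)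
    show "continuous_on {p \<in> ?S. snd p \<le> 1/3} (\<lambda>p. long_arc n (fst p / 3, 3 * snd p))"
      by (rule continuous_on_compose2[OF Suc.IH]) (auto intro!: continuous_intros simp: cantor_third)
    show "continuous_on {p \<in> {p \<in> ?S. 1/3 \<le> snd p}. snd p \<le> 2/3} (\<lambda>p. knaster_chart (Suc n) (fst p, 2 - 3 * snd p))"
      by (rule continuous_on_compose2[OF chart_continuous]) (auto intro!: continuous_intros)
    show "continuous_on {p \<in> {p \<in> ?S. 1/3 \<le> snd p}. 2/3 \<le> snd p} (\<lambda>p. long_arc n (1 - fst p / 3, 3 - 3 * snd p))"
      by (rule continuous_on_compose2[OF Suc.IH]) (auto intro!: continuous_intros simp: cantor_flip_third)
    show "long_arc n (fst p / 3, 3 * snd p) = (if snd p \<le> 2/3 then knaster_chart (Suc n) (fst p, 2 - 3 * snd p)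
        else long_arc n (1 - fst p / 3, 3 - 3 * snd p))"
      if "p \<in> ?S" "snd p = 1/3" for p
      using that(1) long_arc_joints[of "fst p" n] unfolding that(2) by (simp add: mem_Times_iff)
    show "knaster_chart (Suc n) (fst p, 2 - 3 * snd p) = long_arc n (1 - fst p / 3, 3 - 3 * snd p)"
      if "p \<in> {p \<in> ?S. 1/3 \<le> snd p}" "snd p = 2/3" for p
      using that(1) long_arc_joints[of "fst p" n] unfolding that(2) by (simp add: mem_Times_iff)
  qed (auto intro!: continuous_intros)
qed

lemma compact_long_arc: "compact T \<Longrightarrow> T \<subseteq> cantor \<times> {0..1} \<Longrightarrow> compact (long_arc n ` T)"
  using long_arc_continuous compact_continuous_image continuous_on_subset by blast

lemma knaster_core_long_arc: "knaster = core n \<union> long_arc n ` (cantor \<times> {0..1})"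
proof (induction n)
  case 0
  have "(UNIV :: nat set) = insert 0 {0<..}" by auto
  then have "\<Union> (range arcs) = arcs 0 \<union> (\<Union>i\<in>{0<..}. arcs i)" by (metis UN_insert)
  moreover have "long_arc 0 = knaster_chart 0" by auto
  ultimately show ?case unfolding knaster_eq core_def by (simp only: Un_ac)
next
  case (Suc n)
  have 1: "long_arc n (c, t) \<in> long_arc (Suc n) ` (cantor \<times> {0..1})" if ct: "c \<in> cantor" "t \<in> {0..1}" for c t
    using ct(1)
  proof (cases rule: cantor_cases)
    case (1 b)
    then have "long_arc (Suc n) (b, t / 3) = long_arc n (c, t)" using ct(2) unfolding 1(2) by simp
    then show ?thesis using 1(1) ct(2) by (intro image_eqI[of _ _ "(b, t/3)"]) (simp_all del: long_arc.simps)
  next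
    case (2 b)
    have "long_arc (Suc n) (b, 1 - t / 3) = long_arc n (c, t)"
      using 2(1) ct(2) long_arc_joints[of b n] unfolding 2(2) by (cases "t = 1") auto
    then show ?thesis using 2(1) ct(2) by (intro image_eqI[of _ _ "(b, 1 - t/3)"]) (simp_all del: long_arc.simps)
  qed
  have 2: "knaster_chart (Suc n) (c, t) \<in> long_arc (Suc n) ` (cantor \<times> {0..1})" if ct: "c \<in> cantor" "t \<in> {0..1}" for c t
  proof -
    define s where "s = (2 - t) / 3"
    have s: "2 - 3 * s = t" "1/3 \<le> s" "s \<le> 2/3" using ct(2) by (auto simp: s_def diff_divide_distrib)
    have "long_arc (Suc n) (c, s) = knaster_chart (Suc n) (c, t)"
    proof (cases "s = 1/3")
      case True
      have "t = 1" using s(1) unfolding True by simp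
      show ?thesis using long_arc_joints[OF ct(1), of n] unfolding True \<open>t = 1\<close> by simp
    next
      case False
      then show ?thesis using s by simp
    qed
    then show ?thesis using ct(1) s by (intro image_eqI[of _ _ "(c, s)"]) (simp_all del: long_arc.simps)
  qed
  have 3: "long_arc (Suc n) (c, t) \<in> core n \<union> long_arc n ` (cantor \<times> {0..1})" if ct: "c \<in> cantor" "t \<in> {0..1}" for c t
  proof -
    consider "t \<le> 1/3" | "1/3 < t" "t \<le> 2/3" | "2/3 < t" by linarith
    then show ?thesis
    proof cases
      case 1
      then have "(c / 3, 3 * t) \<in> cantor \<times> {0..1}" using ct cantor_third by auto
      then have "long_arc n (c / 3, 3 * t) \<in> long_arc n ` (cantor \<times> {0..1})" by (rule imageI)
      then show ?thesis using 1 by simp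
    next
      case 2
      then have "(c, 2 - 3 * t) \<in> cantor \<times> {0..1}" using ct by auto
      then have "knaster_chart (Suc n) (c, 2 - 3 * t) \<in> arcs (Suc n)" by (rule imageI)
      then have "long_arc (Suc n) (c, t) \<in> arcs (Suc n)" using 2 by simp
      then show ?thesis unfolding core_Suc[of n] by blast
    next
      case 3
      then have "(1 - c / 3, 3 - 3 * t) \<in> cantor \<times> {0..1}" using ct cantor_flip_third by auto
      then have "long_arc n (1 - c / 3, 3 - 3 * t) \<in> long_arc n ` (cantor \<times> {0..1})" by (rule imageI)
      then show ?thesis using 3 by simp
    qed
  qed
  have "knaster \<subseteq> core (Suc n) \<union> long_arc (Suc n) ` (cantor \<times> {0..1})"
    unfolding Suc.IH core_Suc[of n] using 1 2 by (intro Un_least) blast+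
  moreover have "core (Suc n) \<union> long_arc (Suc n) ` (cantor \<times> {0..1}) \<subseteq> knaster"
    using 3 core_subset_knaster[of "Suc n"] unfolding Suc.IH[symmetric] by blast
  ultimately show ?case by (rule equalityI)
qed

lemma arcs_notin_core:
  assumes "p \<in> arcs i" "0 < i" "i \<le> n"
  shows "p \<notin> core n"
proof
  assume "p \<in> core n"
  obtain c t where ct: "c \<in> cantor" "t \<in> {0..1}" "p = knaster_chart i (c, t)" using assms by auto
  have "2 / 3 ^ i \<le> fst p"
    using chart_coordinates(2)[OF ct(1,2), of i] foot_head_bounds(2)[OF ct(1), of i] assms(2) ct(3) by auto
  moreover have "fst p < 2 / 3 ^ i"
  proof -
    from \<open>p \<in> core n\<close> consider "p = (0, 0)" | j where "n < j" "p \<in> arcs j" by (auto simp: core_def)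
    then show ?thesis
    proof cases
      case 2
      then obtain c' t' where ct': "c' \<in> cantor" "t' \<in> {0..1}" "p = knaster_chart j (c', t')" by auto
      have "fst p \<le> 3 / 3 ^ j"
        using chart_coordinates(4)[OF ct'(1,2), of j] foot_head_bounds(3)[OF ct'(1), of j] ct'(3) by simp
      also have "\<dots> < 2 / 3 ^ i" using ternary_scales_disjoint[of i j] 2(1) assms(3) by simp
      finally show ?thesis .
    qed simp
  qed
  ultimately show False by simp
qed

text \<open>The outer thirds of a level \<open>n + 1\<close> arc avoid \<open>core n\<close>, while its middle third lies in
  \<open>core n\<close>; and the two outer thirds use level \<open>n\<close> arcs with parameters in different thirds of the
  Cantor set.\<close>

lemma long_arc_inj:
  shows "c \<in> cantor \<Longrightarrow> t \<in> {0<..<1} \<Longrightarrow> long_arc n (c, t) \<notin> core n"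
    and "c \<in> cantor \<Longrightarrow> t \<in> {0<..<1} \<Longrightarrow> c' \<in> cantor \<Longrightarrow> t' \<in> {0<..<1} \<Longrightarrow>
      long_arc n (c, t) = long_arc n (c', t') \<Longrightarrow> c = c' \<and> t = t'"
proof (induction n arbitrary: c t c' t')
  case 0
  { case 1
    have "long_arc 0 (c, t) \<notin> arcs j" if "j \<noteq> 0" for j
    proof
      assume "long_arc 0 (c, t) \<in> arcs j"
      then obtain c' t' where "c' \<in> cantor" "t' \<in> {0..1}" "knaster_chart 0 (c, t) = knaster_chart j (c', t')"
        by auto
      then show False using chart_disjoint[OF 1, of c' t' 0 j] that by simp
    qed
    moreover have "long_arc 0 (c, t) \<noteq> (0, 0)"
      using chart_coordinates(8)[OF 1(1), of t 0] 1(2) by auto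
    ultimately show ?case by (simp add: core_def) }
  { case 2
    then show ?case using chart_inj[of c t c' t' 0] by simp }
next
  case (Suc n)
  have zones: "t \<in> {0<..<1/3} \<and> long_arc (Suc n) (c, t) = long_arc n (c / 3, 3 * t) \<and> 3 * t \<in> {0<..<1} \<and> c / 3 \<in> cantor \<or>
     t \<in> {1/3..2/3} \<and> long_arc (Suc n) (c, t) = knaster_chart (Suc n) (c, 2 - 3 * t) \<and> 2 - 3 * t \<in> {0..1} \<or>
     t \<in> {2/3<..<1} \<and> long_arc (Suc n) (c, t) = long_arc n (1 - c / 3, 3 - 3 * t) \<and> 3 - 3 * t \<in> {0<..<1} \<and> 1 - c / 3 \<in> cantor"
    if "c \<in> cantor" "t \<in> {0<..<1}" for c t :: real
  proof (cases "t = 1/3")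
    case True
    show ?thesis using long_arc_joints[OF that(1), of n] unfolding True by simp
  next
    case False
    then show ?thesis using that cantor_third[OF that(1)] cantor_flip_third[OF that(1)] by auto
  qed
  have mid: "knaster_chart (Suc n) (c, s) \<in> core n" "knaster_chart (Suc n) (c, s) \<notin> core (Suc n)"
    if "c \<in> cantor" "s \<in> {0..1}" for c s
  proof -
    have *: "knaster_chart (Suc n) (c, s) \<in> arcs (Suc n)" using that by auto
    then show "knaster_chart (Suc n) (c, s) \<in> core n" unfolding core_Suc[of n] by blast
    show "knaster_chart (Suc n) (c, s) \<notin> core (Suc n)" using arcs_notin_core[OF *] by simp
  qed
  { case 1
    have "core (Suc n) \<subseteq> core n" unfolding core_Suc[of n] by blast
    note sub = this
    from zones[OF 1] show ?case
    proof (elim disjE conjE)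
      assume a: "long_arc (Suc n) (c, t) = long_arc n (c / 3, 3 * t)" "3 * t \<in> {0<..<1}" "c / 3 \<in> cantor"
      show ?thesis unfolding a(1) using Suc.IH(1)[OF a(3,2)] sub by (rule contra_subsetD[rotated])
    next
      assume a: "long_arc (Suc n) (c, t) = knaster_chart (Suc n) (c, 2 - 3 * t)" "2 - 3 * t \<in> {0..1}"
      show ?thesis unfolding a(1) by (rule mid(2)[OF 1(1) a(2)])
    next
      assume a: "long_arc (Suc n) (c, t) = long_arc n (1 - c / 3, 3 - 3 * t)" "3 - 3 * t \<in> {0<..<1}" "1 - c / 3 \<in> cantor"
      show ?thesis unfolding a(1) using Suc.IH(1)[OF a(3,2)] sub by (rule contra_subsetD[rotated])
    qed }
  { case 2
    have sep: "c / 3 \<noteq> 1 - c' / 3" "c' / 3 \<noteq> 1 - c / 3"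
      using cantor_bounds[OF 2(1)] cantor_bounds[OF 2(3)] by auto
    have outer: "long_arc n (x, s) \<noteq> knaster_chart (Suc n) (x', s')"
      if "x \<in> cantor" "s \<in> {0<..<1}" "x' \<in> cantor" "s' \<in> {0..1}" for x s x' s'
    proof
      assume "long_arc n (x, s) = knaster_chart (Suc n) (x', s')"
      then show False using Suc.IH(1)[OF that(1,2)] mid(1)[OF that(3,4)] by simp
    qed
    from zones[OF 2(1,2)] zones[OF 2(3,4)] show ?case
    proof (elim disjE conjE)
      assume a: "long_arc (Suc n) (c, t) = long_arc n (c / 3, 3 * t)" "3 * t \<in> {0<..<1}" "c / 3 \<in> cantor"
        "long_arc (Suc n) (c', t') = long_arc n (c' / 3, 3 * t')" "3 * t' \<in> {0<..<1}" "c' / 3 \<in> cantor"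
      show ?thesis using Suc.IH(2)[OF a(3,2,6,5)] 2(5) unfolding a(1,4) by simp
    next
      assume a: "long_arc (Suc n) (c, t) = long_arc n (c / 3, 3 * t)" "3 * t \<in> {0<..<1}" "c / 3 \<in> cantor"
        "long_arc (Suc n) (c', t') = knaster_chart (Suc n) (c', 2 - 3 * t')" "2 - 3 * t' \<in> {0..1}"
      show ?thesis using outer[OF a(3,2) 2(3) a(5)] 2(5) unfolding a(1,4) by contradiction
    next
      assume a: "long_arc (Suc n) (c, t) = long_arc n (c / 3, 3 * t)" "3 * t \<in> {0<..<1}" "c / 3 \<in> cantor"
        "long_arc (Suc n) (c', t') = long_arc n (1 - c' / 3, 3 - 3 * t')" "3 - 3 * t' \<in> {0<..<1}" "1 - c' / 3 \<in> cantor"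
      show ?thesis using Suc.IH(2)[OF a(3,2,6,5)] 2(5) sep unfolding a(1,4) by simp
    next
      assume a: "long_arc (Suc n) (c, t) = knaster_chart (Suc n) (c, 2 - 3 * t)" "2 - 3 * t \<in> {0..1}"
        "long_arc (Suc n) (c', t') = long_arc n (c' / 3, 3 * t')" "3 * t' \<in> {0<..<1}" "c' / 3 \<in> cantor"
      show ?thesis using outer[OF a(5,4) 2(1) a(2)] 2(5)[symmetric] unfolding a(1,3) by contradiction
    next
      assume a: "long_arc (Suc n) (c, t) = knaster_chart (Suc n) (c, 2 - 3 * t)" "2 - 3 * t \<in> {0..1}"
        "long_arc (Suc n) (c', t') = knaster_chart (Suc n) (c', 2 - 3 * t')" "2 - 3 * t' \<in> {0..1}"
      have "knaster_chart (Suc n) (c, 2 - 3 * t) = knaster_chart (Suc n) (c', 2 - 3 * t')"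
        using 2(5) unfolding a(1,3) .
      from chart_inj[OF 2(1) a(2) 2(3) a(4) this] show ?thesis by simp
    next
      assume a: "long_arc (Suc n) (c, t) = knaster_chart (Suc n) (c, 2 - 3 * t)" "2 - 3 * t \<in> {0..1}"
        "long_arc (Suc n) (c', t') = long_arc n (1 - c' / 3, 3 - 3 * t')" "3 - 3 * t' \<in> {0<..<1}" "1 - c' / 3 \<in> cantor"
      show ?thesis using outer[OF a(5,4) 2(1) a(2)] 2(5)[symmetric] unfolding a(1,3) by contradiction
    next
      assume a: "long_arc (Suc n) (c, t) = long_arc n (1 - c / 3, 3 - 3 * t)" "3 - 3 * t \<in> {0<..<1}" "1 - c / 3 \<in> cantor"
        "long_arc (Suc n) (c', t') = long_arc n (c' / 3, 3 * t')" "3 * t' \<in> {0<..<1}" "c' / 3 \<in> cantor"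
      show ?thesis using Suc.IH(2)[OF a(3,2,6,5)] 2(5) sep unfolding a(1,4) by simp
    next
      assume a: "long_arc (Suc n) (c, t) = long_arc n (1 - c / 3, 3 - 3 * t)" "3 - 3 * t \<in> {0<..<1}" "1 - c / 3 \<in> cantor"
        "long_arc (Suc n) (c', t') = knaster_chart (Suc n) (c', 2 - 3 * t')" "2 - 3 * t' \<in> {0..1}"
      show ?thesis using outer[OF a(3,2) 2(3) a(5)] 2(5) unfolding a(1,4) by contradiction
    next
      assume a: "long_arc (Suc n) (c, t) = long_arc n (1 - c / 3, 3 - 3 * t)" "3 - 3 * t \<in> {0<..<1}" "1 - c / 3 \<in> cantor"
        "long_arc (Suc n) (c', t') = long_arc n (1 - c' / 3, 3 - 3 * t')" "3 - 3 * t' \<in> {0<..<1}" "1 - c' / 3 \<in> cantor"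
      show ?thesis using Suc.IH(2)[OF a(3,2,6,5)] 2(5) unfolding a(1,4) by simp
    qed }
qed

section \<open>Connectedness and composants\<close>

text \<open>In a separation into two closed sets, the one that does not contain the origin misses some
  core. But then it misses every long arc of that level, since the ends of these arcs lie in the
  core.\<close>

lemma connected_knaster: "connected knaster"
proof (rule ccontr)
  assume "\<not> connected knaster"
  then obtain A B where AB: "closed A" "closed B" "knaster \<subseteq> A \<union> B" "A \<inter> B \<inter> knaster = {}"
    "A \<inter> knaster \<noteq> {}" "B \<inter> knaster \<noteq> {}" unfolding connected_closed by blast
  have no_origin: False
    if H: "closed H" "closed G" "knaster \<subseteq> H \<union> G" "H \<inter> G \<inter> knaster = {}" "G \<inter> knaster \<noteq> {}" "(0, 0) \<in> H"
    for H G :: "(real \<times> real) set"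
  proof -
    have "(0, 0) \<in> - G" using H knaster_eq by blast
    then obtain r where r: "0 < r" "ball (0, 0) r \<subseteq> - G" using H(2) open_Compl openE by blast
    obtain n where n: "6 / (3::real) ^ n < r"
      using real_arch_pow_inv[of "r/6" "1/3"] r(1) by (auto simp: power_divide field_simps)
    have far: "core n \<inter> G = {}"
    proof -
      have "core n \<subseteq> ball (0, 0) r" using core_small[of n] n by force
      then show ?thesis using r(2) by blast
    qed
    obtain p where p: "p \<in> G" "p \<in> knaster" using H(5) by blast
    then have "p \<notin> core n" using far by blast
    then obtain c t where ct: "c \<in> cantor" "t \<in> {0..1}" "p = long_arc n (c, t)"
      using p(2) unfolding knaster_core_long_arc[of n] by blast
    define J where "J = long_arc n ` ({c} \<times> {0..1})"
    have "connected ({c} \<times> {0..1::real})" by (intro connected_Times) auto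
    moreover have "continuous_on ({c} \<times> {0..1}) (long_arc n)"
      by (rule continuous_on_subset[OF long_arc_continuous]) (use ct in auto)
    ultimately have "connected J" unfolding J_def by (rule connected_continuous_image[rotated])
    moreover have J: "J \<subseteq> knaster" unfolding J_def knaster_core_long_arc[of n] using ct(1) by blast
    moreover have "p \<in> G \<inter> J" using p ct unfolding J_def by blast
    moreover have "long_arc n (c, 0) \<in> H \<inter> J"
    proof -
      have "long_arc n (c, 0) \<in> core n" by (rule long_arc_ends_core[OF ct(1)])
      moreover have "long_arc n (c, 0) \<in> J" unfolding J_def by (intro imageI) auto
      ultimately show ?thesis using J H(3) far by blast
    qed
    ultimately show False using H(1-4) unfolding connected_closed by blast
  qed
  have "(0, 0) \<in> A \<union> B" using AB(3) knaster_eq by blast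
  then show False
    using no_origin[OF AB(1,2,3,4,6)] no_origin[OF AB(2,1) _ _ AB(5)] AB(3,4) by blast
qed

text \<open>A long arc of level \<open>n + k\<close> runs through the level \<open>n\<close> arcs over one point in each
  interval of stage \<open>k\<close> of the Cantor construction, always at the same times.\<close>

lemma long_arc_refine:
  assumes "c \<in> cantor" "t \<in> {0<..<1}"
  shows "\<exists>m t'. t' \<in> {0<..<1} \<and>
    (\<forall>c'\<in>cantor. \<exists>b\<in>cantor. \<bar>b - c\<bar> \<le> 1 / 3 ^ k \<and> long_arc m (c', t') = long_arc n (b, t))"
  using assms
proof (induction k arbitrary: n c t)
  case 0
  have "\<bar>b - c\<bar> \<le> 1" if "b \<in> cantor" for b
    using cantor_bounds[OF that] cantor_bounds[OF 0(1)] by auto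
  then show ?case using 0(2) by (intro exI[of _ n] exI[of _ t]) auto
next
  case (Suc k)
  from Suc.prems(1) show ?case
  proof (cases rule: cantor_cases)
    case (1 b)
    have "t / 3 \<in> {0<..<1}" using Suc.prems(2) by auto
    from Suc.IH[OF 1(1) this, of "Suc n"] obtain m t' where m: "t' \<in> {0<..<1}"
      "\<And>c'. c' \<in> cantor \<Longrightarrow> \<exists>b'\<in>cantor. \<bar>b' - b\<bar> \<le> 1 / 3 ^ k \<and> long_arc m (c', t') = long_arc (Suc n) (b', t / 3)"
      by blast
    have "\<exists>b'\<in>cantor. \<bar>b' - c\<bar> \<le> 1 / 3 ^ Suc k \<and> long_arc m (c', t') = long_arc n (b', t)" if c': "c' \<in> cantor" for c'
    proof -
      obtain b' where b': "b' \<in> cantor" "\<bar>b' - b\<bar> \<le> 1 / 3 ^ k" "long_arc m (c', t') = long_arc (Suc n) (b', t / 3)"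
        using m(2)[OF c'] by blast
      have "\<bar>b' / 3 - c\<bar> = \<bar>b' - b\<bar> / 3" unfolding 1(2) by (simp add: diff_divide_distrib[symmetric])
      then have "\<bar>b' / 3 - c\<bar> \<le> 1 / 3 ^ Suc k" using b'(2) by simp
      moreover have "long_arc m (c', t') = long_arc n (b' / 3, t)" using b'(3) Suc.prems(2) by simp
      ultimately show ?thesis using cantor_third[OF b'(1)] by blast
    qed
    then show ?thesis using m(1) by blast
  next
    case (2 b)
    have t: "1 - t / 3 \<in> {0<..<1}" using Suc.prems(2) by auto
    from Suc.IH[OF 2(1) this, of "Suc n"] obtain m t' where m: "t' \<in> {0<..<1}"
      "\<And>c'. c' \<in> cantor \<Longrightarrow> \<exists>b'\<in>cantor. \<bar>b' - b\<bar> \<le> 1 / 3 ^ k \<and> long_arc m (c', t') = long_arc (Suc n) (b', 1 - t / 3)"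
      by blast
    have "\<exists>b'\<in>cantor. \<bar>b' - c\<bar> \<le> 1 / 3 ^ Suc k \<and> long_arc m (c', t') = long_arc n (b', t)" if c': "c' \<in> cantor" for c'
    proof -
      obtain b' where b': "b' \<in> cantor" "\<bar>b' - b\<bar> \<le> 1 / 3 ^ k" "long_arc m (c', t') = long_arc (Suc n) (b', 1 - t / 3)"
        using m(2)[OF c'] by blast
      have "\<bar>1 - b' / 3 - c\<bar> = \<bar>b' - b\<bar> / 3" unfolding 2(2) by (simp add: diff_divide_distrib[symmetric])
      then have "\<bar>1 - b' / 3 - c\<bar> \<le> 1 / 3 ^ Suc k" using b'(2) by simp
      moreover have "long_arc m (c', t') = long_arc n (1 - b' / 3, t)" using b'(3) Suc.prems(2) by simp
      ultimately show ?thesis using cantor_flip_third[OF b'(1)] by blast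
    qed
    then show ?thesis using m(1) by blast
  qed
qed

lemma chart_in_long_arc:
  assumes "t \<in> {0<..<1}"
  obtains t' where "t' \<in> {0<..<1}" "\<And>c. knaster_chart i (c, t) = long_arc i (c, t')"
proof (cases i)
  case 0
  then show ?thesis using that assms by auto
next
  case (Suc n)
  define s where "s = (2 - t) / 3"
  have s: "2 - 3 * s = t" "1/3 < s" "s < 2/3" using assms by (auto simp: s_def diff_divide_distrib)
  show ?thesis by (rule that[of s]) (use s Suc in auto)
qed

text \<open>The open set contains the points at a fixed time on the level \<open>i\<close> arcs over a small piece of
  the Cantor set; by \<open>long_arc_refine\<close> all long arcs of some higher level run through such points, at a
  common time.\<close>

lemma open_contains_cross_section:
  assumes "open U" "U \<inter> knaster \<noteq> {}"
  obtains m t where "t \<in> {0<..<1}" "long_arc m ` (cantor \<times> {t}) \<subseteq> U"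
proof -
  obtain i c t where ct: "c \<in> cantor" "t \<in> {0..1}" "knaster_chart i (c, t) \<in> U"
  proof -
    obtain p where p: "p \<in> U" "p \<in> knaster" using assms(2) by blast
    show ?thesis
    proof (cases "p = (0, 0)")
      case True
      then have "knaster_chart 0 (0, 0) = p" using chart_ends(1)[OF cantor_zero, of 0] by (simp add: foot_def)
      then show ?thesis using that[of 0 0 0] cantor_zero p(1) by auto
    next
      case False
      then show ?thesis using that p unfolding knaster_eq by blast
    qed
  qed
  have cont: "isCont (\<lambda>s. knaster_chart i (c, s)) s" for s
  proof -
    have "continuous_on UNIV (\<lambda>s. knaster_chart i (c, s))"
      by (rule continuous_on_compose2[OF chart_continuous]) (use ct(1) in \<open>auto intro!: continuous_intros\<close>)
    then show ?thesis by (simp add: continuous_on_eq_continuous_at)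
  qed
  have "\<forall>\<^sub>F s in at t. knaster_chart i (c, s) \<in> U"
    using cont[of t] assms(1) ct(3) unfolding isCont_def by (rule topological_tendstoD)
  then obtain r where r: "0 < r" "\<And>s. s \<noteq> t \<Longrightarrow> dist s t < r \<Longrightarrow> knaster_chart i (c, s) \<in> U"
    unfolding eventually_at by blast
  have "t \<in> closure {0<..<1}" using ct(2) by simp
  then obtain s where s: "s \<in> {0<..<1}" "dist s t < r" using r(1) unfolding closure_approachable by blast
  have "knaster_chart i (c, s) \<in> U" using r(2)[OF _ s(2)] ct(3) by (cases "s = t") auto
  moreover obtain s' where s': "s' \<in> {0<..<1}" "\<And>c. knaster_chart i (c, s) = long_arc i (c, s')"
    using chart_in_long_arc[OF s(1)] by blast
  ultimately have inU: "long_arc i (c, s') \<in> U" by simp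
  have "continuous_on cantor (\<lambda>c. long_arc i (c, s'))"
    by (rule continuous_on_compose2[OF long_arc_continuous]) (use s'(1) in \<open>auto intro!: continuous_intros\<close>)
  then have "((\<lambda>c. long_arc i (c, s')) \<longlongrightarrow> long_arc i (c, s')) (at c within cantor)"
    using ct(1) unfolding continuous_on_def by blast
  from topological_tendstoD[OF this assms(1) inU]
  have "\<forall>\<^sub>F b in at c within cantor. long_arc i (b, s') \<in> U" .
  then obtain e where e: "0 < e" "\<And>b. b \<in> cantor \<Longrightarrow> b \<noteq> c \<Longrightarrow> dist b c < e \<Longrightarrow> long_arc i (b, s') \<in> U"
    unfolding eventually_at by blast
  obtain k where k: "1 / (3::real) ^ k < e"
    using real_arch_pow_inv[of e "1/3"] e(1) by (auto simp: power_divide)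
  obtain m t' where m: "t' \<in> {0<..<1}"
    "\<And>c'. c' \<in> cantor \<Longrightarrow> \<exists>b\<in>cantor. \<bar>b - c\<bar> \<le> 1 / 3 ^ k \<and> long_arc m (c', t') = long_arc i (b, s')"
    using long_arc_refine[OF ct(1) s'(1), of k i] by blast
  have "long_arc m (c', t') \<in> U" if c': "c' \<in> cantor" for c'
  proof -
    obtain b where b: "b \<in> cantor" "\<bar>b - c\<bar> \<le> 1 / 3 ^ k" "long_arc m (c', t') = long_arc i (b, s')"
      using m(2)[OF c'] by blast
    have "dist b c < e" using b(2) k by (simp add: dist_real_def)
    then show ?thesis using e(2)[OF b(1)] inU b(3) by (cases "b = c") auto
  qed
  then show ?thesis using that[OF m(1), of m] by blast
qed

lemma cross_section_Suc:
  assumes "t \<in> {0<..<1}"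
  shows "t / 3 \<in> {0<..<1}" "long_arc (Suc n) ` (cantor \<times> {t / 3}) \<subseteq> long_arc n ` (cantor \<times> {t})"
proof -
  show "t / 3 \<in> {0<..<1}" using assms by auto
  have "long_arc (Suc n) (c, t / 3) = long_arc n (c / 3, t)" for c using assms by simp
  then show "long_arc (Suc n) ` (cantor \<times> {t / 3}) \<subseteq> long_arc n ` (cantor \<times> {t})"
    by (auto simp del: long_arc.simps intro!: imageI cantor_third)
qed

lemma cross_section_cofinal:
  assumes "t \<in> {0<..<1}"
  shows "\<exists>t'\<in>{0<..<1}. long_arc (n + k) ` (cantor \<times> {t'}) \<subseteq> long_arc n ` (cantor \<times> {t})"
proof (induction k)
  case (Suc k)
  then obtain t' where t': "t' \<in> {0<..<1}" "long_arc (n + k) ` (cantor \<times> {t'}) \<subseteq> long_arc n ` (cantor \<times> {t})" by blast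
  have "long_arc (n + Suc k) ` (cantor \<times> {t' / 3}) \<subseteq> long_arc n ` (cantor \<times> {t})"
    using cross_section_Suc(2)[OF t'(1), of "n + k"] t'(2) unfolding add_Suc_right by (rule subset_trans)
  then show ?case using cross_section_Suc(1)[OF t'(1)] by (rule rev_bexI[rotated])
qed (use assms in auto)

text \<open>A point \<open>z\<close> of the diagonal is labelled by the foot of the lower arc that ends there. A
  relation is used in place of a function because its compactness follows from
  \<open>closed_shrinking_union\<close>, with no continuity argument at the origin.\<close>

definition labels :: "(real \<times> real) set" where
  "labels = {(0, 0)} \<union> (\<Union>i\<in>{0<..}. (\<lambda>c. (foot i c, foot i c)) ` cantor \<union> (\<lambda>c. (head i c, foot i c)) ` cantor)"

lemma labels_iff:
  "(z, l) \<in> labels \<longleftrightarrow> z = 0 \<and> l = 0 \<or> (\<exists>i c. 0 < i \<and> c \<in> cantor \<and> l = foot i c \<and> (z = foot i c \<or> z = head i c))"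
  unfolding labels_def by auto

lemma closed_labels: "closed labels"
  unfolding labels_def
proof (rule closed_shrinking_union)
  fix i :: nat assume "i \<in> {0<..}"
  have "continuous_on cantor (foot i)" "continuous_on cantor (head i)"
    unfolding foot_def head_def by (cases "i = 0"; auto intro!: continuous_intros)+
  then have "compact ((\<lambda>c. (foot i c, foot i c)) ` cantor)" "compact ((\<lambda>c. (head i c, foot i c)) ` cantor)"
    by (auto intro!: compact_continuous_image continuous_on_Pair compact_cantor)
  then show "closed ((\<lambda>c. (foot i c, foot i c)) ` cantor \<union> (\<lambda>c. (head i c, foot i c)) ` cantor)"
    by (intro closed_Un compact_imp_closed)
  have "(z, foot i c) \<in> cball (0, 0) (6 / 3 ^ i)" if "c \<in> cantor" "z = foot i c \<or> z = head i c" for z c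
  proof -
    have "\<bar>z\<bar> \<le> 3 / 3 ^ i" "\<bar>foot i c\<bar> \<le> 3 / 3 ^ i"
      using foot_head_bounds(1,3,4)[OF that(1), of i] that(2) by auto
    then show ?thesis using norm_Pair_le[of z "foot i c"] by (simp add: zero_prod_def[symmetric])
  qed
  then show "(\<lambda>c. (foot i c, foot i c)) ` cantor \<union> (\<lambda>c. (head i c, foot i c)) ` cantor \<subseteq> cball (0, 0) (6 / 3 ^ i)"
    by blast
qed

lemma labels_total: "z \<in> cantor \<Longrightarrow> \<exists>l. (z, l) \<in> labels"
proof (cases "z = 0")
  case True
  then show ?thesis unfolding labels_iff by blast
next
  case False
  assume "z \<in> cantor"
  from this False obtain i c where "0 < i" "c \<in> cantor" "z = foot i c \<or> z = head i c"
    by (rule foot_head_exhaust)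
  then have "(z, foot i c) \<in> labels" unfolding labels_iff by blast
  then show ?thesis ..
qed

lemma labels_unique:
  assumes "(z, l) \<in> labels" "(z, l') \<in> labels"
  shows "l = l'"
proof -
  have pos: "0 < foot i c" "0 < head i c" if "0 < i" "c \<in> cantor" for i c
  proof -
    have "(0::real) < 2 / 3 ^ i" by simp
    also have "\<dots> \<le> foot i c" using foot_head_bounds(2)[OF that(2)] that(1) by auto
    finally show "0 < foot i c" "0 < head i c" using foot_head_bounds(1)[OF that(2), of i] by auto
  qed
  show ?thesis
  proof (cases "z = 0")
    case True
    have "l = 0" if zl: "(z, l) \<in> labels" for l
    proof (rule ccontr)
      assume "l \<noteq> 0"
      then obtain i c where "0 < i" "c \<in> cantor" "z = foot i c \<or> z = head i c"
        using zl unfolding labels_iff by auto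
      then show False using pos[of i c] True by auto
    qed
    from this[OF assms(1)] this[OF assms(2)] show ?thesis by simp
  next
    case False
    then obtain i c where i: "0 < i" "c \<in> cantor" "l = foot i c" "z = foot i c \<or> z = head i c"
      using assms(1) unfolding labels_iff by auto
    obtain j c' where j: "0 < j" "c' \<in> cantor" "l' = foot j c'" "z = foot j c' \<or> z = head j c'"
      using False assms(2) unfolding labels_iff by auto
    have "foot i c = foot j c' \<or> head i c = head j c'"
      using i(4) j(4) foot_head_same_arc(3)[OF i(2) j(2) i(1) j(1)] foot_head_same_arc(3)[OF j(2) i(2) j(1) i(1)]
      by auto
    then have "i = j \<and> c = c'" using foot_head_same_arc(1,2)[OF i(2) j(2) i(1) j(1)] by blast
    then show ?thesis using i(3) j(3) by simp
  qed
qed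

lemma labels_cantor: "(z, l) \<in> labels \<Longrightarrow> l \<in> cantor"
  unfolding labels_iff by (auto intro: cantor_zero foot_head_cantor)

lemma finite_same_label: "finite {z. (z, l) \<in> labels}"
proof (cases "\<exists>i c. 0 < i \<and> c \<in> cantor \<and> l = foot i c")
  case True
  then obtain i c where ic: "0 < i" "c \<in> cantor" "l = foot i c" by blast
  have "z \<in> {0, foot i c, head i c}" if zl: "(z, l) \<in> labels" for z
  proof (cases "z = 0")
    case False
    then obtain j c' where j: "0 < j" "c' \<in> cantor" "l = foot j c'" "z = foot j c' \<or> z = head j c'"
      using zl unfolding labels_iff by auto
    have "foot i c = foot j c'" using j(3) ic(3) by simp
    from foot_head_same_arc(1)[OF ic(2) j(2) ic(1) j(1) this] show ?thesis using j(4) by blast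
  qed simp
  then have "{z. (z, l) \<in> labels} \<subseteq> {0, foot i c, head i c}" by blast
  then show ?thesis by (rule finite_subset) simp
next
  case False
  then have "{z. (z, l) \<in> labels} \<subseteq> {0}" unfolding labels_iff by blast
  then show ?thesis by (rule finite_subset) simp
qed

section \<open>Cutting along a cross section\<close>

lemma long_arc_in_core_iff:
  assumes "c \<in> cantor" "t \<in> {0..1}"
  shows "long_arc m (c, t) \<in> core m \<longleftrightarrow> t = 0 \<or> t = 1"
proof (cases "t = 0 \<or> t = 1")
  case True
  then show ?thesis using long_arc_ends_core[OF assms(1), of m] by auto
next
  case False
  then have "t \<in> {0<..<1}" using assms(2) by auto
  then show ?thesis using long_arc_inj(1)[OF assms(1)] False by blast
qed

lemma chart_in_core:
  assumes "m < i" "c \<in> cantor" "t \<in> {0..1}"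
  shows "knaster_chart i (c, t) \<in> core m"
proof -
  have "knaster_chart i (c, t) \<in> arcs i" using assms(2,3) by (intro imageI) simp
  then show ?thesis using assms(1) unfolding core_def by blast
qed

text \<open>Cutting the long arcs of level \<open>m\<close> at time \<open>t0\<close> leaves components each of which is an arc
  of the core together with the cut pieces that are attached to its two ends; the origin, with one
  such piece, forms a component of its own. This relation assigns to every point the label of its
  component.\<close>

definition cut_labels :: "nat \<Rightarrow> real \<Rightarrow> ((real \<times> real) \<times> real) set" where
  "cut_labels m t0 =
    {(long_arc m (c, t), l) | c t l. c \<in> cantor \<and> t \<in> {0..t0} \<and> (c / 3 ^ Suc m, l) \<in> labels} \<union>
    {(long_arc m (c, t), l) | c t l. c \<in> cantor \<and> t \<in> {t0..1} \<and> (1 / 3 ^ m - c / 3 ^ Suc m, l) \<in> labels} \<union>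
    ({((0, 0), 0)} \<union> (\<Union>i\<in>{m<..}. (\<lambda>x. (knaster_chart i x, foot i (fst x))) ` (cantor \<times> {0..1})))"

lemma cut_labelsE:
  assumes "(p, l) \<in> cut_labels m t0"
  obtains c t where "p = long_arc m (c, t)" "c \<in> cantor" "t \<in> {0..t0}" "(c / 3 ^ Suc m, l) \<in> labels"
    | c t where "p = long_arc m (c, t)" "c \<in> cantor" "t \<in> {t0..1}" "(1 / 3 ^ m - c / 3 ^ Suc m, l) \<in> labels"
    | "p = (0, 0)" "l = 0"
    | i c t where "m < i" "c \<in> cantor" "t \<in> {0..1}" "p = knaster_chart i (c, t)" "l = foot i c"
  using assms unfolding cut_labels_def by auto

lemma compact_long_arc_labels:
  assumes "T \<subseteq> {0..1}" "compact T" "continuous_on UNIV g"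
  shows "compact {(long_arc m (c, t), l) | c t l. c \<in> cantor \<and> t \<in> T \<and> (g c, l) \<in> labels}"
proof -
  define D where "D = (cantor \<times> T) \<times> cantor \<inter> (\<lambda>x. (g (fst (fst x)), snd x)) -` labels"
  have "continuous_on UNIV (\<lambda>x :: (real \<times> real) \<times> real. (g (fst (fst x)), snd x))"
    by (intro continuous_intros continuous_on_compose2[OF assms(3)]) auto
  then have "compact D" unfolding D_def
    by (intro compact_Int_closed compact_Times compact_cantor assms closed_vimage closed_labels)
  moreover have "continuous_on D (\<lambda>x. (long_arc m (fst x), snd x))"
    by (intro continuous_intros continuous_on_compose2[OF long_arc_continuous])
      (use assms(1) in \<open>auto simp: D_def\<close>)
  ultimately have "compact ((\<lambda>x. (long_arc m (fst x), snd x)) ` D)" by (rule compact_continuous_image[rotated])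
  moreover have "(\<lambda>x. (long_arc m (fst x), snd x)) ` D =
      {(long_arc m (c, t), l) | c t l. c \<in> cantor \<and> t \<in> T \<and> (g c, l) \<in> labels}"
    unfolding D_def using labels_cantor by (force simp: image_iff)
  ultimately show ?thesis by simp
qed

lemma compact_cut_labels:
  assumes "t0 \<in> {0<..<1}"
  shows "compact (cut_labels m t0)"
proof -
  define E where "E i = (\<lambda>x. (knaster_chart i x, foot i (fst x))) ` (cantor \<times> {0..1})" for i
  have "compact (E i)" for i
    unfolding E_def
  proof (rule compact_continuous_image)
    show "continuous_on (cantor \<times> {0..1}) (\<lambda>x. (knaster_chart i x, foot i (fst x)))"
      unfolding foot_def
      by (cases "i = 0"; intro continuous_on_Pair continuous_on_subset[OF chart_continuous])
        (auto intro!: continuous_intros)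
  qed (intro compact_Times compact_cantor compact_Icc)
  then have cl: "closed (E i)" for i by (simp add: compact_imp_closed)
  have small: "E i \<subseteq> cball ((0, 0), 0) (9 / 3 ^ i)" for i
  proof
    fix y assume "y \<in> E i"
    then obtain x where x: "x \<in> cantor \<times> {0..1}" "y = (knaster_chart i x, foot i (fst x))" by (auto simp: E_def)
    have "knaster_chart i x \<in> cball (0, 0) (6 / 3 ^ i)" using arcs_small[of i] x(1) by blast
    then have "norm (knaster_chart i x) \<le> 6 / 3 ^ i" by (simp add: zero_prod_def[symmetric])
    moreover have "\<bar>foot i (fst x)\<bar> \<le> 3 / 3 ^ i"
      using foot_head_bounds(1,3,4)[of "fst x" i] x(1) by (auto simp: mem_Times_iff)
    ultimately have "norm y \<le> 9 / 3 ^ i"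
      using norm_Pair_le[of "knaster_chart i x" "foot i (fst x)"] x(2) by simp
    then show "y \<in> cball ((0, 0), 0) (9 / 3 ^ i)" by (simp add: zero_prod_def[symmetric])
  qed
  have "compact ({((0, 0), 0)} \<union> (\<Union>i\<in>{m<..}. E i))"
  proof -
    have "E i \<subseteq> cball ((0, 0), 0) 9" for i
    proof -
      have "(9::real) / 3 ^ i \<le> 9" by (simp add: divide_le_eq)
      then show ?thesis by (rule subset_trans[OF small subset_cball])
    qed
    then have "{((0, 0), 0)} \<union> (\<Union>i\<in>{m<..}. E i) \<subseteq> cball ((0, 0), 0) 9"
      by (intro Un_least UN_least) auto
    then have "bounded ({((0, 0), 0)} \<union> (\<Union>i\<in>{m<..}. E i))" by (rule bounded_subset[OF bounded_cball])
    moreover have "closed ({((0, 0), 0)} \<union> (\<Union>i\<in>{m<..}. E i))" by (rule closed_shrinking_union[OF cl small])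
    ultimately show ?thesis unfolding compact_eq_bounded_closed by blast
  qed
  note k3 = this
  have k1: "compact {(long_arc m (c, t), l) | c t l. c \<in> cantor \<and> t \<in> {0..t0} \<and> (c / 3 ^ Suc m, l) \<in> labels}"
    using assms by (intro compact_long_arc_labels) (auto intro!: continuous_intros)
  have k2: "compact {(long_arc m (c, t), l) | c t l. c \<in> cantor \<and> t \<in> {t0..1} \<and> (1 / 3 ^ m - c / 3 ^ Suc m, l) \<in> labels}"
    using assms by (intro compact_long_arc_labels) (auto intro!: continuous_intros)
  show ?thesis using compact_Un[OF compact_Un[OF k1 k2] k3] unfolding cut_labels_def E_def .
qed

lemma cut_labels_total:
  assumes "p \<in> knaster"
  shows "\<exists>l. (p, l) \<in> cut_labels m t0"
proof (cases "p \<in> core m")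
  case True
  then show ?thesis
    unfolding core_def cut_labels_def by fastforce
next
  case False
  then obtain c t where ct: "c \<in> cantor" "t \<in> {0..1}" "p = long_arc m (c, t)"
    using assms unfolding knaster_core_long_arc[of m] by auto
  obtain l where l: "(c / 3 ^ Suc m, l) \<in> labels" using labels_total[OF cantor_power[OF ct(1)]] by blast
  obtain l' where l': "(1 / 3 ^ m - c / 3 ^ Suc m, l') \<in> labels"
    using labels_total[OF long_arc_ends_core(3)[OF ct(1)]] by blast
  show ?thesis
  proof (cases "t \<le> t0")
    case True
    then have "(p, l) \<in> cut_labels m t0" unfolding cut_labels_def using ct l by auto
    then show ?thesis ..
  next
    case False
    then have "(p, l') \<in> cut_labels m t0" unfolding cut_labels_def using ct l' by auto
    then show ?thesis ..
  qed
qed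

lemma cut_labels_cantor: "(p, l) \<in> cut_labels m t0 \<Longrightarrow> l \<in> cantor"
  by (erule cut_labelsE) (auto dest: labels_cantor intro: cantor_zero foot_head_cantor)

lemma cut_labels_long_arc:
  assumes "(long_arc m (c, t), l) \<in> cut_labels m t0" "c \<in> cantor" "t \<in> {0<..<1}" "t0 \<in> {0<..<1}"
  shows "t \<le> t0 \<and> (c / 3 ^ Suc m, l) \<in> labels \<or> t0 \<le> t \<and> (1 / 3 ^ m - c / 3 ^ Suc m, l) \<in> labels"
proof -
  have notin: "long_arc m (c, t) \<notin> core m" using long_arc_inj(1) assms by blast
  have same: "c' = c \<and> t' = t" if "long_arc m (c, t) = long_arc m (c', t')" "c' \<in> cantor" "t' \<in> {0..1}" for c' t'
  proof -
    have "t' \<noteq> 0" "t' \<noteq> 1" using long_arc_in_core_iff[OF that(2,3), of m] notin that(1) by auto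
    then have "t' \<in> {0<..<1}" using that(3) by auto
    then show ?thesis using long_arc_inj(2)[OF assms(2,3) that(2) _ that(1)] by simp
  qed
  from assms(1) show ?thesis
  proof (cases rule: cut_labelsE)
    case (1 c' t')
    then have "c' = c \<and> t' = t" using assms(4) by (intro same) auto
    then show ?thesis using 1 by auto
  next
    case (2 c' t')
    then have "c' = c \<and> t' = t" using assms(4) by (intro same) auto
    then show ?thesis using 2 by auto
  next
    case 3
    then show ?thesis using notin by (simp add: core_def)
  next
    case (4 i c' t')
    then have "long_arc m (c, t) \<in> core m" using chart_in_core by simp
    then show ?thesis using notin by simp
  qed
qed

lemma cut_labels_diagonal:
  assumes "((z, z), l) \<in> cut_labels m t0" "(z, z) \<in> core m" "t0 \<in> {0<..<1}"
  shows "(z, l) \<in> labels"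
  using assms(1)
proof (cases rule: cut_labelsE)
  case (1 c t)
  then have "t = 0 \<or> t = 1" using long_arc_in_core_iff[of c t m] assms(2,3) by auto
  then have "t = 0" using 1 assms(3) by auto
  then show ?thesis using 1 long_arc_ends(1)[of c m] by simp
next
  case (2 c t)
  then have "t = 0 \<or> t = 1" using long_arc_in_core_iff[of c t m] assms(2,3) by auto
  then have "t = 1" using 2 assms(3) by auto
  then show ?thesis using 2 long_arc_ends(2)[of c m] by simp
next
  case 3
  then show ?thesis by (simp add: labels_iff)
next
  case (4 i c t)
  have "t = 0 \<or> t = 1"
    using chart_coordinates(8)[OF 4(2,3), of i] 4(3) unfolding 4(4)[symmetric] by fastforce
  then have "z = foot i c \<or> z = head i c" using chart_ends[OF 4(2), of i] 4(4) by auto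
  moreover have "0 < i" using 4(1) by simp
  ultimately show ?thesis using 4(2,5) unfolding labels_iff by blast
qed

lemma cut_labels_core:
  assumes "(knaster_chart i (c, t), l) \<in> cut_labels m t0" "m < i" "c \<in> cantor" "t \<in> {0<..<1}" "t0 \<in> {0<..<1}"
  shows "l = foot i c"
proof -
  let ?p = "knaster_chart i (c, t)"
  have t: "t \<in> {0..1}" using assms(4) by simp
  have core: "?p \<in> core m" using assms(2,3) t by (rule chart_in_core)
  have off: "?p \<noteq> (z, z)" for z
    using chart_coordinates(8)[OF assms(3) t, of i] assms(4) by (metis fst_conv greaterThanLessThan_iff snd_conv)
  have ends: "?p \<noteq> long_arc m (c', t')" if "c' \<in> cantor" "t' \<in> {0..1}" for c' t'
    using long_arc_in_core_iff[OF that, of m] core off long_arc_ends[OF that(1), of m] by metis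
  from assms(1) show ?thesis
  proof (cases rule: cut_labelsE)
    case (1 c' t')
    then show ?thesis using ends[of c' t'] assms(5) by auto
  next
    case (2 c' t')
    then show ?thesis using ends[of c' t'] assms(5) by auto
  next
    case 3
    then show ?thesis using off by metis
  next
    case (4 j c' t')
    then have "i = j" using chart_disjoint[OF assms(3,4) 4(2,3), of i j] by blast
    then show ?thesis using chart_inj(1)[OF assms(3) t 4(2,3), of i] 4 by simp
  qed
qed

lemma cut_labels_unique:
  assumes "(p, l) \<in> cut_labels m t0" "(p, l') \<in> cut_labels m t0" "p \<in> knaster" "t0 \<in> {0<..<1}"
    "p \<notin> long_arc m ` (cantor \<times> {t0})"
  shows "l = l'"
proof (cases "p \<in> core m")
  case True
  show ?thesis
  proof (cases "fst p = snd p")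
    case diag: True
    then obtain z where "p = (z, z)" by (metis prod.collapse)
    then show ?thesis using cut_labels_diagonal labels_unique assms(1,2,4) True by metis
  next
    case False
    then obtain i c t where ict: "m < i" "c \<in> cantor" "t \<in> {0..1}" "p = knaster_chart i (c, t)"
      using True unfolding core_def by auto
    have "t \<in> {0<..<1}" using False chart_ends[OF ict(2), of i] ict(3,4) by (cases "t = 0 \<or> t = 1") auto
    then show ?thesis using cut_labels_core[OF _ ict(1,2) _ assms(4), of t] assms(1,2) ict(4) by metis
  qed
next
  case False
  then obtain c t where ct: "c \<in> cantor" "t \<in> {0..1}" "p = long_arc m (c, t)"
    using assms(3) unfolding knaster_core_long_arc[of m] by auto
  then have "t \<in> {0<..<1}" using False long_arc_in_core_iff[OF ct(1,2), of m] by (cases "t = 0 \<or> t = 1") auto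
  moreover have "t \<noteq> t0" using assms(5) ct by auto
  ultimately show ?thesis
    using cut_labels_long_arc[OF _ ct(1) _ assms(4)] assms(1,2) labels_unique ct(3) by (metis order_antisym)
qed

text \<open>Labels are elements of the Cantor set, so two different ones are separated by a threshold \<open>v\<close>
  outside it. The points with a label below \<open>v\<close> and those with a label above \<open>v\<close> form projections of
  compact sets, hence closed sets, and off the cut every point has only one label.\<close>

lemma connected_cut_label:
  assumes "connected S" "S \<subseteq> knaster" "t0 \<in> {0<..<1}" "S \<inter> long_arc m ` (cantor \<times> {t0}) = {}"
    "p \<in> S" "q \<in> S" "(p, l) \<in> cut_labels m t0" "(q, l') \<in> cut_labels m t0"
  shows "l = l'"
proof -
  have no_less: False if pq: "p \<in> S" "q \<in> S" "(p, l) \<in> cut_labels m t0" "(q, l') \<in> cut_labels m t0" "l < l'" for p q l l'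
  proof -
    obtain v where v: "l < v" "v < l'" "v \<notin> cantor"
      using cantor_separated[OF cut_labels_cantor[OF pq(3)] cut_labels_cantor[OF pq(4)] pq(5)] by blast
    define A where "A = fst ` (cut_labels m t0 \<inter> UNIV \<times> {..v})"
    define B where "B = fst ` (cut_labels m t0 \<inter> UNIV \<times> {v..})"
    have "compact (cut_labels m t0 \<inter> UNIV \<times> {..v})" "compact (cut_labels m t0 \<inter> UNIV \<times> {v..})"
      by (intro compact_Int_closed compact_cut_labels assms(3) closed_Times closed_UNIV closed_atMost closed_atLeast)+
    moreover have "continuous_on T fst" for T :: "((real \<times> real) \<times> real) set" by (intro continuous_intros)
    ultimately have "compact A" "compact B" unfolding A_def B_def
      using compact_continuous_image by blast+
    then have "closed A" "closed B" by (simp_all add: compact_imp_closed)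
    moreover have "S \<subseteq> A \<union> B"
    proof
      fix x assume "x \<in> S"
      then obtain y where y: "(x, y) \<in> cut_labels m t0" using cut_labels_total assms(2) by blast
      then show "x \<in> A \<union> B" unfolding A_def B_def by (cases "y \<le> v") (auto intro!: image_eqI[of _ fst "(x, y)"])
    qed
    moreover have "A \<inter> B \<inter> S = {}"
    proof -
      have False if x: "x \<in> S" "(x, y) \<in> cut_labels m t0" "(x, y') \<in> cut_labels m t0" "y \<le> v" "v \<le> y'" for x y y'
      proof -
        have "y = y'" using cut_labels_unique[OF x(2,3) _ assms(3)] x(1) assms(2,4) by blast
        then show False using x(2,4,5) v(3) cut_labels_cantor by (metis order_antisym)
      qed
      then show ?thesis unfolding A_def B_def by fastforce
    qed
    moreover have "A \<inter> S \<noteq> {}" "B \<inter> S \<noteq> {}"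
      using that v unfolding A_def B_def by force+
    ultimately show False using assms(1) unfolding connected_closed by blast
  qed
  show ?thesis using no_less[of p q l l'] no_less[of q p l' l] assms(5-8) by (meson linorder_neqE_linordered_idom)
qed

text \<open>A long arc is a chain of arcs, so density of a complement passes from the arcs to it.\<close>

lemma holes_in_long_arc:
  assumes "\<And>i c s1 s2. c \<in> cantor \<Longrightarrow> 0 \<le> s1 \<Longrightarrow> s1 < s2 \<Longrightarrow> s2 \<le> 1 \<Longrightarrow>
      \<exists>s. s1 < s \<and> s < s2 \<and> knaster_chart i (c, s) \<notin> S"
    and "c \<in> cantor" "0 \<le> s1" "s1 < s2" "s2 \<le> 1"
  shows "\<exists>s. s1 < s \<and> s < s2 \<and> long_arc n (c, s) \<notin> S"
  using assms(2-)
proof (induction n arbitrary: c s1 s2)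
  case 0
  then show ?case using assms(1)[of c s1 s2 0] by simp
next
  case (Suc n)
  consider "s1 < 1/3" | "1/3 \<le> s1" "s1 < 2/3" | "2/3 \<le> s1" by linarith
  then show ?case
  proof cases
    case 1
    have "\<exists>s. 3 * s1 < s \<and> s < min 1 (3 * s2) \<and> long_arc n (c / 3, s) \<notin> S"
      by (rule Suc.IH[OF cantor_third[OF Suc.prems(1)]]) (use Suc.prems 1 in auto)
    then obtain s where s: "3 * s1 < s" "s < min 1 (3 * s2)" "long_arc n (c / 3, s) \<notin> S" by blast
    then show ?thesis by (intro exI[of _ "s / 3"]) auto
  next
    case 2
    have "\<exists>s. max 0 (2 - 3 * s2) < s \<and> s < 2 - 3 * s1 \<and> knaster_chart (Suc n) (c, s) \<notin> S"
      by (rule assms(1)) (use Suc.prems 2 in auto)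
    then obtain s where s: "max 0 (2 - 3 * s2) < s" "s < 2 - 3 * s1" "knaster_chart (Suc n) (c, s) \<notin> S" by blast
    define r where "r = (2 - s) / 3"
    have "s = 2 - 3 * r" by (simp add: r_def diff_divide_distrib)
    then show ?thesis using s 2 by (intro exI[of _ r]) auto
  next
    case 3
    have "\<exists>s. 3 - 3 * s2 < s \<and> s < 3 - 3 * s1 \<and> long_arc n (1 - c / 3, s) \<notin> S"
      by (rule Suc.IH[OF cantor_flip_third[OF Suc.prems(1)]]) (use Suc.prems 3 in auto)
    then obtain s where s: "3 - 3 * s2 < s" "s < 3 - 3 * s1" "long_arc n (1 - c / 3, s) \<notin> S" by blast
    define r where "r = (3 - s) / 3"
    have "s = 3 - 3 * r" by (simp add: r_def diff_divide_distrib)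
    then show ?thesis using s 3 by (intro exI[of _ r]) auto
  qed
qed

text \<open>A point \<open>p\<close> other than the origin lies on a long arc outside some core, and by the common label
  \<open>S\<close> meets only finitely many long arcs of that level outside the core. Between two holes close to
  \<open>p\<close>, the piece of the arc through \<open>p\<close> is therefore closed and relatively open in \<open>S\<close>, and it can be
  chosen so short that it omits \<open>q\<close>.\<close>

lemma connected_with_holes_singleton:
  assumes S: "connected S" "S \<subseteq> knaster"
    and cut: "t0 \<in> {0<..<1}" "S \<inter> long_arc m ` (cantor \<times> {t0}) = {}"
    and holes: "\<And>i c s1 s2. c \<in> cantor \<Longrightarrow> 0 \<le> s1 \<Longrightarrow> s1 < s2 \<Longrightarrow> s2 \<le> 1 \<Longrightarrow>
      \<exists>s. s1 < s \<and> s < s2 \<and> knaster_chart i (c, s) \<notin> S"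
    and "p \<in> S" "q \<in> S"
  shows "p = q"
proof -
  have away: "q = p" if pq: "p \<in> S" "q \<in> S" "p \<noteq> (0, 0)" for p q
  proof (rule ccontr)
    assume "q \<noteq> p"
    have "0 < norm p" using pq(3) by (simp add: zero_prod_def)
    then obtain k where k: "6 / (3::real) ^ k < norm p"
      using real_arch_pow_inv[of "norm p / 6" "1/3"] by (auto simp: power_divide field_simps)
    define n where "n = m + k"
    have pcore: "p \<notin> core n"
    proof
      assume "p \<in> core n"
      then have "norm p \<le> 6 / 3 ^ n" using core_small[of n] by (force simp: zero_prod_def[symmetric])
      also have "\<dots> \<le> 6 / 3 ^ k" unfolding n_def by (intro divide_left_mono power_increasing) auto
      finally show False using k by simp
    qed
    obtain t1 where t1: "t1 \<in> {0<..<1}" "long_arc n ` (cantor \<times> {t1}) \<subseteq> long_arc m ` (cantor \<times> {t0})"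
      using cross_section_cofinal[OF cut(1), of m k] unfolding n_def by blast
    have cut': "S \<inter> long_arc n ` (cantor \<times> {t1}) = {}" using cut(2) t1(2) by blast
    obtain l where l: "(p, l) \<in> cut_labels n t1" using cut_labels_total pq(1) S(2) by blast
    define F where "F = {c \<in> cantor. (c / 3 ^ Suc n, l) \<in> labels \<or> (1 / 3 ^ n - c / 3 ^ Suc n, l) \<in> labels}"
    have "finite ((\<lambda>c. c / 3 ^ Suc n) -` {z. (z, l) \<in> labels})"
      "finite ((\<lambda>c. 1 / 3 ^ n - c / 3 ^ Suc n) -` {z. (z, l) \<in> labels})"
      by (intro finite_vimageI finite_same_label; simp add: inj_def)+
    then have finF: "finite F" unfolding F_def by (auto intro: rev_finite_subset)
    have inF: "c \<in> F" if cs: "c \<in> cantor" "s \<in> {0<..<1}" "long_arc n (c, s) \<in> S" for c s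
    proof -
      obtain l' where l': "(long_arc n (c, s), l') \<in> cut_labels n t1" using cut_labels_total cs(3) S(2) by blast
      then have "l' = l" using connected_cut_label[OF S t1(1) cut' cs(3) pq(1) l' l] by simp
      then show ?thesis using cut_labels_long_arc[OF l' cs(1,2) t1(1)] cs(1) by (auto simp: F_def)
    qed
    obtain c t where ct: "c \<in> cantor" "t \<in> {0..1}" "p = long_arc n (c, t)"
      using pcore pq(1) S(2) unfolding knaster_core_long_arc[of n] by auto
    have t: "t \<in> {0<..<1}"
      using pcore ct long_arc_in_core_iff[OF ct(1,2), of n] by (cases "t = 0 \<or> t = 1") auto
    obtain e where e: "0 < e" "e \<le> t" "e \<le> 1 - t" "\<And>s. s \<in> {0<..<1} \<Longrightarrow> \<bar>s - t\<bar> < e \<Longrightarrow> q \<noteq> long_arc n (c, s)"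
    proof (cases "\<exists>s\<in>{0<..<1}. q = long_arc n (c, s)")
      case True
      then obtain s where s: "s \<in> {0<..<1}" "q = long_arc n (c, s)" by blast
      have "s \<noteq> t" using s ct(3) \<open>q \<noteq> p\<close> by auto
      have "s' = s" if "s' \<in> {0<..<1}" "q = long_arc n (c, s')" for s'
        using long_arc_inj(2)[OF ct(1) s(1) ct(1) that(1), of n] s(2) that(2) by simp
      then show ?thesis using that[of "min \<bar>s - t\<bar> (min t (1 - t))"] \<open>s \<noteq> t\<close> t by fastforce
    next
      case False
      then show ?thesis using that[of "min t (1 - t)"] t by auto
    qed
    obtain u where u: "t - e < u" "u < t" "long_arc n (c, u) \<notin> S"
      using holes_in_long_arc[OF holes ct(1), of "t - e" t n] e t by auto
    obtain v where v: "t < v" "v < t + e" "long_arc n (c, v) \<notin> S"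
      using holes_in_long_arc[OF holes ct(1), of t "t + e" n] e t by auto
    \<comment> \<open>\<open>P\<close> and \<open>Q\<close> share only the two ends of \<open>P\<close> (off the core), and these are holes.\<close>
    define P where "P = long_arc n ` ({c} \<times> {u..v})"
    define Q where "Q = core n \<union> long_arc n ` (cantor \<times> ({0..u} \<union> {v..1})) \<union> long_arc n ` ((F - {c}) \<times> {0..1})"
    have uv: "{u..v} \<subseteq> {0<..<1}" using u v e by auto
    have "closed P" unfolding P_def using uv ct(1)
      by (intro compact_imp_closed compact_long_arc compact_Times) force+
    moreover have "closed Q" unfolding Q_def using uv u v finF
      by (intro closed_Un closed_core compact_imp_closed compact_long_arc compact_Times compact_cantor compact_Un
          compact_Icc finite_imp_compact) (force simp: F_def)+
    moreover have "S \<subseteq> P \<union> Q"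
    proof
      fix x assume x: "x \<in> S"
      show "x \<in> P \<union> Q"
      proof (cases "x \<in> core n")
        case True then show ?thesis by (simp add: Q_def)
      next
        case False
        then obtain c' s where cs: "c' \<in> cantor" "s \<in> {0..1}" "x = long_arc n (c', s)"
          using x S(2) unfolding knaster_core_long_arc[of n] by auto
        have s: "s \<in> {0<..<1}"
          using False cs long_arc_in_core_iff[OF cs(1,2), of n] by (cases "s = 0 \<or> s = 1") auto
        have "c' \<in> F" using inF[OF cs(1) s] x cs(3) by simp
        show ?thesis
        proof (cases "c' = c")
          case True
          have "x \<in> P" if "s \<in> {u..v}" using True cs that by (auto simp: P_def)
          moreover have "x \<in> Q" if "s \<notin> {u..v}"
          proof -
            have "(c', s) \<in> cantor \<times> ({0..u} \<union> {v..1})" using cs that by auto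
            then show ?thesis unfolding Q_def cs(3) by blast
          qed
          ultimately show ?thesis by blast
        next
          case False
          then have "(c', s) \<in> (F - {c}) \<times> {0..1}" using cs \<open>c' \<in> F\<close> by auto
          then show ?thesis unfolding Q_def cs(3) by blast
        qed
      qed
    qed
    moreover have "P \<inter> Q \<inter> S = {}"
    proof -
      have False if s: "s \<in> {u..v}" "long_arc n (c, s) \<in> Q" "long_arc n (c, s) \<in> S" for s
      proof -
        have s01: "s \<in> {0<..<1}" using s(1) uv by blast
        have ncore: "long_arc n (c, s) \<notin> core n" using long_arc_inj(1)[OF ct(1) s01] .
        have same: "c' = c \<and> s' = s" if "long_arc n (c, s) = long_arc n (c', s')" "c' \<in> cantor" "s' \<in> {0..1}" for c' s'
        proof -
          have "s' \<in> {0<..<1}"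
            using ncore that long_arc_in_core_iff[OF that(2,3), of n] by (cases "s' = 0 \<or> s' = 1") auto
          then show ?thesis using long_arc_inj(2)[OF ct(1) s01 that(2) _ that(1)] by simp
        qed
        from s(2) ncore consider c' s' where "c' \<in> cantor" "s' \<in> {0..u} \<union> {v..1}" "long_arc n (c, s) = long_arc n (c', s')"
          | c' s' where "c' \<in> F - {c}" "s' \<in> {0..1}" "long_arc n (c, s) = long_arc n (c', s')"
          unfolding Q_def by blast
        then show False
        proof cases
          case 1
          then have "c' = c \<and> s' = s" using u v e t by (intro same) auto
          then have "s = u \<or> s = v" using 1(2) s(1) by auto
          then show False using s(3) u(3) v(3) by auto
        next
          case 2
          then show False using same[of c' s'] by (auto simp: F_def)
        qed
      qed
      note none = this
      show ?thesis
      proof (rule ccontr)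
        assume "P \<inter> Q \<inter> S \<noteq> {}"
        then obtain x where x: "x \<in> P" "x \<in> Q" "x \<in> S" by blast
        then obtain s where "s \<in> {u..v}" "x = long_arc n (c, s)" unfolding P_def by auto
        then show False using none x(2,3) by simp
      qed
    qed
    moreover have "p \<in> P \<inter> S" using ct u v pq(1) by (auto simp: P_def)
    moreover have "q \<in> Q \<inter> S"
    proof -
      have "q \<notin> P"
      proof
        assume "q \<in> P"
        then obtain s where "s \<in> {u..v}" "q = long_arc n (c, s)" by (auto simp: P_def)
        moreover have "s \<in> {0<..<1}" "\<bar>s - t\<bar> < e" using \<open>s \<in> {u..v}\<close> uv u v by (blast, auto)
        ultimately show False using e(4)[of s] by blast
      qed
      then show ?thesis using pq(2) \<open>S \<subseteq> P \<union> Q\<close> by blast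
    qed
    ultimately show False using S(1) unfolding connected_closed by blast
  qed
  show ?thesis using away[of p q] away[of q p] assms(6,7) by metis
qed

section \<open>The punctured continuum\<close>

locale punctured = jumps d a for d a :: "nat \<Rightarrow> real" +
  fixes q :: "nat \<Rightarrow> real"
  assumes rationals: "range q = \<rat>"
begin

definition height :: "real \<Rightarrow> real" where "height r = arctan r / pi + 1 / 2"

lemma Xi_eq: "Xi (c, r) = (c, height r)"
  by (simp add: Xi_def height_def)

lemma height_less_iff: "height r < height s \<longleftrightarrow> r < s"
  by (simp add: height_def divide_less_cancel arctan_less_iff)

lemma height_inj: "height r = height s \<longleftrightarrow> r = s"
  using height_less_iff by (metis linorder_neqE_linordered_idom less_irrefl)

lemma height_bounds: "height r \<in> {0<..<1}"
  using arctan_bounded[of r] by (auto simp: height_def field_simps)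

lemma height_surj:
  assumes "t \<in> {0<..<1}"
  obtains r where "height r = t"
proof -
  have "pi * (t - 1/2) < pi * (1/2)" "pi * (-(1/2)) < pi * (t - 1/2)"
    using assms by (intro mult_strict_left_mono; simp)+
  then have "arctan (tan (pi * (t - 1/2))) = pi * (t - 1/2)" by (intro arctan_tan) auto
  then have "height (tan (pi * (t - 1/2))) = t" by (simp add: height_def)
  then show ?thesis by (rule that)
qed

definition chart :: "nat \<Rightarrow> real \<times> real \<Rightarrow> real \<times> real" where
  "chart i = knaster_chart i \<circ> Xi"

lemma chart_eq: "chart i (c, r) = knaster_chart i (c, height r)"
  by (simp add: chart_def Xi_eq)

lemma continuous_chart: "continuous_on (cantor \<times> UNIV) (chart i)"
proof -
  have "continuous_on (cantor \<times> UNIV) Xi"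
    unfolding Xi_def case_prod_beta by (intro continuous_intros) auto
  moreover have "Xi ` (cantor \<times> UNIV) \<subseteq> cantor \<times> UNIV" by (auto simp: Xi_eq)
  ultimately show ?thesis unfolding chart_def
    by (intro continuous_on_compose continuous_on_subset[OF chart_continuous])
qed

lemma chart_eq_iff:
  assumes "c \<in> cantor" "c' \<in> cantor"
  shows "chart i (c, r) = chart j (c', r') \<longleftrightarrow> i = j \<and> c = c' \<and> r = r'"
proof
  assume eq: "chart i (c, r) = chart j (c', r')"
  have h: "height r \<in> {0..1}" "height r' \<in> {0..1}" using height_bounds[of r] height_bounds[of r'] by auto
  have "i = j"
    using chart_disjoint[OF assms(1) height_bounds assms(2) h(2), of i j] eq unfolding chart_eq by blast
  then show "i = j \<and> c = c' \<and> r = r'"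
    using chart_inj[OF assms(1) h(1) assms(2) h(2), of i] eq unfolding chart_eq by (simp add: height_inj)
qed simp

lemma chart_in_knaster: "c \<in> cantor \<Longrightarrow> chart i (c, r) \<in> knaster"
  unfolding knaster_def chart_eq using height_bounds by blast

definition hole :: "nat \<Rightarrow> nat \<Rightarrow> (real \<times> real) set" where
  "hole i n = chart i ` \<Gamma> (q n)"

lemma compact_hole: "compact (hole i n)"
proof -
  have "\<Gamma> (q n) \<subseteq> cantor \<times> UNIV" using Gamma_subset by blast
  then show ?thesis unfolding hole_def
    by (intro compact_continuous_image compact_Gamma continuous_on_subset[OF continuous_chart])
qed

lemma chart_in_hole_iff:
  assumes "c \<in> cantor" shows "chart i (c, r) \<in> hole j n \<longleftrightarrow> i = j \<and> (c, r) \<in> \<Gamma> (q n)"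
proof
  assume "chart i (c, r) \<in> hole j n"
  then obtain c' r' where c': "(c', r') \<in> \<Gamma> (q n)" "chart i (c, r) = chart j (c', r')" unfolding hole_def by auto
  then have "c' \<in> cantor" using Gamma_subset by blast
  then show "i = j \<and> (c, r) \<in> \<Gamma> (q n)" using c' chart_eq_iff[OF assms, of c' i r j r'] by simp
qed (auto simp: hole_def)

abbreviation W :: "(real \<times> real) set" where "W \<equiv> W_set (X3 d a q)"

lemma Y_eq: "Y_set d a q = cantor \<times> UNIV - (\<Union>n. \<Gamma> (q n))"
proof -
  have "top_of_set (cantor \<times> UNIV) closure_of cantor_graph (\<lambda>c. f c + q n) = \<Gamma> (q n)" for n
  proof -
    have "cantor_graph (\<lambda>c. f c + q n) \<subseteq> cantor \<times> UNIV" by (auto simp: cantor_graph_def)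
    moreover have "\<Gamma> (q n) \<subseteq> cantor \<times> UNIV" using Gamma_subset by blast
    ultimately show ?thesis by (simp add: closure_of_subtopology Int_absorb1)
  qed
  then show ?thesis unfolding Y_set_def by simp
qed

lemma W_eq: "W = knaster_diagonal \<union> (\<Union>i. chart i ` (cantor \<times> UNIV - (\<Union>n. \<Gamma> (q n))))"
  unfolding W_set_def X3_def Y_eq chart_def image_comp ..

lemma W_eq_knaster_minus_holes: "W = knaster - (\<Union>i n. hole i n)"
proof
  show "W \<subseteq> knaster - (\<Union>i n. hole i n)"
  proof
    fix p assume "p \<in> W"
    then consider "p \<in> knaster_diagonal" | i c r where "c \<in> cantor" "p = chart i (c, r)" "\<And>n. (c, r) \<notin> \<Gamma> (q n)"
      unfolding W_eq by blast
    then show "p \<in> knaster - (\<Union>i n. hole i n)"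
    proof cases
      case 1
      have "p \<notin> hole i n" for i n
      proof
        assume "p \<in> hole i n"
        then obtain c r where cr: "(c, r) \<in> \<Gamma> (q n)" "p = chart i (c, r)" unfolding hole_def by auto
        then have "c \<in> cantor" using Gamma_subset by blast
        then show False using chart_off_diagonal[OF _ height_bounds] 1 cr(2) unfolding chart_eq by blast
      qed
      then show ?thesis using 1 by (auto simp: knaster_def)
    next
      case 2
      then show ?thesis using chart_in_hole_iff[OF 2(1)] chart_in_knaster[OF 2(1)] by auto
    qed
  qed
  show "knaster - (\<Union>i n. hole i n) \<subseteq> W"
  proof
    fix p assume p: "p \<in> knaster - (\<Union>i n. hole i n)"
    then consider "p \<in> knaster_diagonal" | i c t where "c \<in> cantor" "t \<in> {0<..<1}" "p = knaster_chart i (c, t)"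
      unfolding knaster_def by blast
    then show "p \<in> W"
    proof cases
      case 1 then show ?thesis by (simp add: W_eq)
    next
      case 2
      obtain r where r: "height r = t" using height_surj[OF 2(2)] .
      then have pr: "p = chart i (c, r)" using 2(3) by (simp add: chart_eq)
      then have "(c, r) \<notin> (\<Union>n. \<Gamma> (q n))" using p chart_in_hole_iff[OF 2(1)] by auto
      then show ?thesis unfolding W_eq pr using 2(1) by blast
    qed
  qed
qed

lemma W_subset_knaster: "W \<subseteq> knaster"
  unfolding W_eq_knaster_minus_holes by blast

lemma W_space_eq: "W_space (X3 d a q) = top_of_set W"
  unfolding W_space_def subtopology_subtopology using W_subset_knaster by (simp add: Int_absorb1)

lemma completely_metrizable_W: "completely_metrizable_space (W_space (X3 d a q))"
  unfolding W_space_def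
proof (rule completely_metrizable_space_gdelta_in)
  show "completely_metrizable_space (top_of_set knaster)"
    by (intro completely_metrizable_space_closedin completely_metrizable_space_euclidean)
      (simp add: compact_imp_closed compact_knaster)
  have "gdelta_in (top_of_set knaster) (\<Inter>((\<lambda>(i, n). knaster - hole i n) ` UNIV))"
  proof (rule gdelta_in_Inter)
    fix T assume "T \<in> (\<lambda>(i, n). knaster - hole i n) ` UNIV"
    then obtain i n where T: "T = knaster - hole i n" by auto
    have "T = knaster \<inter> - hole i n" using T by blast
    moreover have "open (- hole i n)" using compact_hole compact_imp_closed by blast
    ultimately have "openin (top_of_set knaster) T" by (simp add: openin_open_Int)
    then show "gdelta_in (top_of_set knaster) T" by (rule open_imp_gdelta_in)
  qed auto
  moreover have "\<Inter>((\<lambda>(i, n). knaster - hole i n) ` UNIV) = W" unfolding W_eq_knaster_minus_holes by auto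
  ultimately show "gdelta_in (top_of_set knaster) W" by simp
qed

lemma heights_between:
  assumes "0 \<le> s1" "s1 < s2" "s2 \<le> 1"
  obtains r1 r2 where "r1 < r2" "\<And>r. r1 < r \<Longrightarrow> r < r2 \<Longrightarrow> s1 < height r \<and> height r < s2"
proof -
  obtain r1 where r1: "height r1 = (2 * s1 + s2) / 3" using height_surj[of "(2 * s1 + s2) / 3"] assms by auto
  obtain r2 where r2: "height r2 = (s1 + 2 * s2) / 3" using height_surj[of "(s1 + 2 * s2) / 3"] assms by auto
  have "r1 < r2" using height_less_iff[of r1 r2] r1 r2 assms by auto
  moreover have "s1 < height r \<and> height r < s2" if "r1 < r" "r < r2" for r
    using height_less_iff[of r1 r] height_less_iff[of r r2] that r1 r2 assms by auto
  ultimately show ?thesis by (rule that)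
qed

text \<open>Over \<open>c\<close> the graphs of \<open>f + q n\<close> have the heights \<open>f c + q n\<close>, a dense set.\<close>

lemma W_misses_arcs_densely:
  assumes "c \<in> cantor" "0 \<le> s1" "s1 < s2" "s2 \<le> 1"
  shows "\<exists>s. s1 < s \<and> s < s2 \<and> knaster_chart i (c, s) \<notin> W"
proof -
  obtain r1 r2 where r: "r1 < r2" "\<And>r. r1 < r \<Longrightarrow> r < r2 \<Longrightarrow> s1 < height r \<and> height r < s2"
    using heights_between[OF assms(2-4)] by blast
  have "\<exists>x\<in>\<rat>. r1 - f c < x \<and> x < r2 - f c" by (rule Rats_dense_in_real) (use r(1) in simp)
  then obtain n where n: "r1 - f c < q n" "q n < r2 - f c" unfolding rationals[symmetric] by blast
  have "(c, f c + q n) \<in> \<Gamma> (q n)"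
    by (rule subsetD[OF closure_subset]) (use assms(1) in \<open>auto simp: cantor_graph_def\<close>)
  then have "knaster_chart i (c, height (f c + q n)) \<notin> W"
    using chart_in_hole_iff[OF assms(1), of i "f c + q n" i n] unfolding W_eq_knaster_minus_holes chart_eq by blast
  moreover have "s1 < height (f c + q n) \<and> height (f c + q n) < s2" by (rule r(2)) (use n in auto)
  ultimately show ?thesis by blast
qed

text \<open>Only countably many heights over \<open>c\<close> are removed.\<close>

lemma W_meets_arcs_densely:
  assumes "c \<in> cantor" "0 \<le> s1" "s1 < s2" "s2 \<le> 1"
  shows "\<exists>s. s1 < s \<and> s < s2 \<and> knaster_chart i (c, s) \<in> W"
proof -
  obtain r1 r2 where r: "r1 < r2" "\<And>r. r1 < r \<Longrightarrow> r < r2 \<Longrightarrow> s1 < height r \<and> height r < s2"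
    using heights_between[OF assms(2-4)] by blast
  define Z where "Z = range (\<lambda>n. f c + q n) \<union> range (\<lambda>n. f_right c + q n)"
  have "countable Z" unfolding Z_def by auto
  then have "\<not> {r1<..<r2} \<subseteq> Z" using uncountable_open_interval[of r1 r2] r(1) countable_subset by blast
  then obtain x where "x \<in> {r1<..<r2}" "x \<notin> Z" by blast
  then have x: "r1 < x" "x < r2" "x \<notin> Z" by auto
  have "(c, x) \<notin> (\<Union>n. \<Gamma> (q n))" using x(3) Gamma_fibre unfolding Z_def by blast
  then have "knaster_chart i (c, height x) \<in> W" unfolding W_eq chart_eq[symmetric] using assms(1) by blast
  then show ?thesis using r(2)[OF x(1,2)] by blast
qed

lemma W_dense: "knaster \<subseteq> closure W"
proof
  fix p assume "p \<in> knaster"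
  then consider "p \<in> knaster_diagonal" | i c t where "c \<in> cantor" "t \<in> {0<..<1}" "p = knaster_chart i (c, t)"
    unfolding knaster_def by blast
  then show "p \<in> closure W"
  proof cases
    case 1
    then show ?thesis using closure_subset[of W] by (auto simp: W_eq)
  next
    case 2
    have "continuous_on UNIV (\<lambda>s. knaster_chart i (c, s))"
      by (rule continuous_on_compose2[OF chart_continuous]) (use 2(1) in \<open>auto intro!: continuous_intros\<close>)
    then have cont: "isCont (\<lambda>s. knaster_chart i (c, s)) t" by (simp add: continuous_on_eq_continuous_at)
    show ?thesis unfolding closure_approachable
    proof (intro allI impI)
      fix e :: real assume "0 < e"
      then obtain r where r: "0 < r" "\<And>s. dist s t < r \<Longrightarrow> dist (knaster_chart i (c, s)) (knaster_chart i (c, t)) < e"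
        using cont unfolding continuous_at_eps_delta by blast
      obtain s where s: "t < s" "s < min 1 (t + r)" "knaster_chart i (c, s) \<in> W"
        using W_meets_arcs_densely[OF 2(1), of t "min 1 (t + r)" i] 2(2) r(1) by auto
      then have "dist (knaster_chart i (c, s)) p < e" using r(2)[of s] 2(3) by (simp add: dist_real_def)
      then show "\<exists>y\<in>W. dist y p < e" using s(3) by blast
    qed
  qed
qed

lemma dense_if_connected:
  assumes S: "connected S" "S \<subseteq> W" "x \<in> S" "y \<in> S" "x \<noteq> y"
  shows "W \<subseteq> closure S"
proof (rule ccontr)
  assume "\<not> W \<subseteq> closure S"
  then have "- closure S \<inter> knaster \<noteq> {}" using W_subset_knaster by blast
  moreover have "open (- closure S)" by (simp add: open_Compl)
  ultimately obtain m t where mt: "t \<in> {0<..<1}" "long_arc m ` (cantor \<times> {t}) \<subseteq> - closure S"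
    using open_contains_cross_section by metis
  then have cut: "S \<inter> long_arc m ` (cantor \<times> {t}) = {}" using closure_subset[of S] by blast
  have "\<exists>s. s1 < s \<and> s < s2 \<and> knaster_chart i (c, s) \<notin> S"
    if "c \<in> cantor" "0 \<le> s1" "s1 < s2" "s2 \<le> 1" for i c s1 s2
    using W_misses_arcs_densely[OF that, of i] S(2) by blast
  from connected_with_holes_singleton[OF S(1) _ mt(1) cut this S(3,4)] show False
    using S(2,5) W_subset_knaster by blast
qed

end

section \<open>Connectedness of the punctured continuum\<close>

context punctured
begin

text \<open>The fibre of \<open>\<Gamma> r\<close> over \<open>c\<close> contains no point above \<open>f_right c + r\<close> and none below \<open>f c + r\<close>. When
  \<open>s\<close> is one of these two values, it is the hypothesis on \<open>(c, s)\<close> that excludes \<open>s' = s\<close>.\<close>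

lemma fibre_above:
  assumes "(c, s) \<notin> \<Gamma> r" "f_right c + r \<le> s" "s \<le> s'"
  shows "(c, s') \<notin> \<Gamma> r"
proof
  assume "(c, s') \<in> \<Gamma> r"
  moreover from this have "s' \<le> s" using Gamma_fibre[of c s' r] f_le_f_right[of c] assms(2) by auto
  ultimately show False using assms(1,3) by simp
qed

lemma fibre_below:
  assumes "(c, s) \<notin> \<Gamma> r" "s \<le> f c + r" "s' \<le> s"
  shows "(c, s') \<notin> \<Gamma> r"
proof
  assume "(c, s') \<in> \<Gamma> r"
  moreover from this have "s \<le> s'" using Gamma_fibre[of c s' r] f_le_f_right[of c] assms(2) by auto
  ultimately show False using assms(1,3) by simp
qed

text \<open>A box around a point of \<open>\<Gamma> r\<close> is divided into the part above and
  the part below \<open>\<Gamma> r\<close>, but the two parts communicate through the vertical gaps that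
  \<open>\<Gamma> r\<close> has over the points \<open>d n\<close>: such a gap is approached from the left by points above \<open>\<Gamma> r\<close>
  and from the right by points below it.  Hence the complement of \<open>\<Gamma> r\<close> cannot be split.\<close>

lemma box_minus_Gamma_unsplit:
  fixes L :: "real \<times> real \<Rightarrow> bool"
  assumes base: "(c0, r0) \<in> \<Gamma> r" "0 < e0"
    and local_const: "\<And>c1 r1. c1 \<in> cantor \<Longrightarrow> \<bar>c1 - c0\<bar> < e0 \<Longrightarrow> \<bar>r1 - r0\<bar> < e0 \<Longrightarrow> (c1, r1) \<notin> \<Gamma> r \<Longrightarrow>
      \<exists>D>0. \<forall>c\<in>cantor. \<bar>c - c1\<bar> < D \<longrightarrow> (c, r1) \<notin> \<Gamma> r \<and> L (c, r1) = L (c1, r1)"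
    and vertical: "\<And>c r1 r2. c \<in> cantor \<Longrightarrow> \<bar>c - c0\<bar> < e0 \<Longrightarrow> \<bar>r1 - r0\<bar> < e0 \<Longrightarrow> \<bar>r2 - r0\<bar> < e0 \<Longrightarrow> r1 \<le> r2 \<Longrightarrow>
      (\<And>x. r1 \<le> x \<Longrightarrow> x \<le> r2 \<Longrightarrow> (c, x) \<notin> \<Gamma> r) \<Longrightarrow> L (c, r1) = L (c, r2)"
  obtains D e b where "0 < D" "D \<le> e0" "0 < e" "e < e0"
    "\<And>c s. c \<in> cantor \<Longrightarrow> \<bar>c - c0\<bar> < D \<Longrightarrow> \<bar>s - r0\<bar> < e \<Longrightarrow> (c, s) \<notin> \<Gamma> r \<Longrightarrow> L (c, s) = b"
proof -
  have c0: "c0 \<in> cantor" using base(1) Gamma_subset by blast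
  \<comment> \<open>The height \<open>e\<close> of the box is chosen so that \<open>\<Gamma> r\<close> misses the middle of its top and bottom.\<close>
  have "infinite {0<..<e0}" using base(2) infinite_Ioo by blast
  then have "\<not> {0<..<e0} \<subseteq> {\<bar>f c0 + r - r0\<bar>, \<bar>f_right c0 + r - r0\<bar>}" using finite_subset by blast
  then obtain e where "e \<in> {0<..<e0}" "e \<notin> {\<bar>f c0 + r - r0\<bar>, \<bar>f_right c0 + r - r0\<bar>}" by blast
  then have e: "0 < e" "e < e0" "e \<noteq> \<bar>f c0 + r - r0\<bar>" "e \<noteq> \<bar>f_right c0 + r - r0\<bar>" by auto
  have top: "(c0, r0 + e) \<notin> \<Gamma> r" and bottom: "(c0, r0 - e) \<notin> \<Gamma> r"
    using Gamma_fibre[of c0 "r0 + e" r] Gamma_fibre[of c0 "r0 - e" r] e by auto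
  obtain D1 where D1: "0 < D1" "\<And>c. c \<in> cantor \<Longrightarrow> \<bar>c - c0\<bar> < D1 \<Longrightarrow> (c, r0 + e) \<notin> \<Gamma> r \<and> L (c, r0 + e) = L (c0, r0 + e)"
    using local_const[OF c0, of "r0 + e"] top e by auto
  obtain D2 where D2: "0 < D2" "\<And>c. c \<in> cantor \<Longrightarrow> \<bar>c - c0\<bar> < D2 \<Longrightarrow> (c, r0 - e) \<notin> \<Gamma> r \<and> L (c, r0 - e) = L (c0, r0 - e)"
    using local_const[OF c0, of "r0 - e"] bottom e by auto
  define D where "D = min e0 (min D1 D2)"
  have D: "0 < D" "D \<le> e0" using D1(1) D2(1) base(2) by (auto simp: D_def)
  have above: "L (c, s) = L (c0, r0 + e)"
    if "c \<in> cantor" "\<bar>c - c0\<bar> < D" "\<bar>s - r0\<bar> < e" "(c, s) \<notin> \<Gamma> r" "f_right c + r \<le> s" for c s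
  proof -
    have "L (c, s) = L (c, r0 + e)"
      by (rule vertical) (use that e D fibre_above[OF that(4,5)] in auto)
    then show ?thesis using D1(2)[OF that(1)] that(2) by (simp add: D_def)
  qed
  have below: "L (c, s) = L (c0, r0 - e)"
    if "c \<in> cantor" "\<bar>c - c0\<bar> < D" "\<bar>s - r0\<bar> < e" "(c, s) \<notin> \<Gamma> r" "s \<le> f c + r" for c s
  proof -
    have "L (c, r0 - e) = L (c, s)"
      by (rule vertical) (use that e D fibre_below[OF that(4,5)] in auto)
    then show ?thesis using D2(2)[OF that(1)] that(2) by (simp add: D_def)
  qed
  \<comment> \<open>Points in a gap of \<open>\<Gamma> r\<close> have the label of the upper and of the lower part.\<close>
  have gap: "L (d n, s) = L (c0, r0 + e)" "L (d n, s) = L (c0, r0 - e)"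
    if n: "\<bar>d n - c0\<bar> < D" "\<bar>s - r0\<bar> < e" "f (d n) + r < s" "s < f_right (d n) + r" for n s
  proof -
    have dn: "d n \<in> cantor_nonendpoints" using d_nonendpoint by blast
    then have dc: "d n \<in> cantor" by (simp add: cantor_nonendpoints_def)
    have "(d n, s) \<notin> \<Gamma> r" using Gamma_fibre[of "d n" s r] n by auto
    then obtain D3 where D3: "0 < D3" "\<And>c. c \<in> cantor \<Longrightarrow> \<bar>c - d n\<bar> < D3 \<Longrightarrow> (c, s) \<notin> \<Gamma> r \<and> L (c, s) = L (d n, s)"
      using local_const[OF dc, of s] n D e by auto
    define w where "w = min D3 (D - \<bar>d n - c0\<bar>)"
    have w: "0 < w" using D3(1) n(1) by (simp add: w_def)
    obtain c where c: "c \<in> cantor" "d n - w < c" "c < d n" using cantor_nonendpoint_approach(1)[OF dn w] by blast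
    have "\<bar>c - d n\<bar> < D3" "\<bar>c - c0\<bar> < D" using c unfolding w_def by auto
    then show "L (d n, s) = L (c0, r0 + e)"
      using D3(2)[OF c(1)] above[OF c(1) _ n(2)] f_right_le_f[OF c(3)] n(3) by auto
    obtain c' where c': "c' \<in> cantor" "d n < c'" "c' < d n + w" using cantor_nonendpoint_approach(2)[OF dn w] by blast
    have "\<bar>c' - d n\<bar> < D3" "\<bar>c' - c0\<bar> < D" using c' unfolding w_def by auto
    then show "L (d n, s) = L (c0, r0 - e)"
      using D3(2)[OF c'(1)] below[OF c'(1) _ n(2)] f_right_le_f[OF c'(2)] n(4) by auto
  qed
  obtain n where n: "\<bar>d n - c0\<bar> < min D e" "\<bar>f (d n) + r - r0\<bar> < min D e"
    using Gamma_near_jump[OF base(1), of "min D e"] D(1) e(1) by auto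
  have "f (d n) + r < min (f_right (d n) + r) (r0 + e)" using f_less_f_right[of n] n(2) by auto
  then obtain s where s: "f (d n) + r < s" "s < min (f_right (d n) + r) (r0 + e)" using dense by blast
  have same: "L (c0, r0 - e) = L (c0, r0 + e)"
    using gap[of n s] n s by auto
  have "L (c, s) = L (c0, r0 + e)"
    if cs: "c \<in> cantor" "\<bar>c - c0\<bar> < D" "\<bar>s - r0\<bar> < e" "(c, s) \<notin> \<Gamma> r" for c s
  proof -
    consider "f_right c + r \<le> s" | "s \<le> f c + r" | "f c + r < s" "s < f_right c + r" by linarith
    then show ?thesis
    proof cases
      case 1 then show ?thesis using above cs by blast
    next
      case 2 then show ?thesis using below[OF cs] same by blast
    next
      case 3
      then have "c \<in> range d" using f_right_eq_f[of c] by force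
      then show ?thesis using gap(1) cs(2,3) 3 by blast
    qed
  qed
  then show ?thesis using that[OF D e(1,2)] by blast
qed

lemma connected_W: "connected W"
proof (rule ccontr)
  assume "\<not> connected W"
  then obtain A' B' where AB': "closed A'" "closed B'" "W \<subseteq> A' \<union> B'" "A' \<inter> B' \<inter> W = {}"
    "A' \<inter> W \<noteq> {}" "B' \<inter> W \<noteq> {}" unfolding connected_closed by blast
  \<comment> \<open>With these smaller sets, points of \<open>A \<inter> B\<close> are limits of both parts of \<open>W\<close>.\<close>
  define A where "A = closure (A' \<inter> W)"
  define B where "B = closure (B' \<inter> W)"
  have sub: "A \<subseteq> A'" "B \<subseteq> B'" unfolding A_def B_def using AB' by (auto intro: closure_minimal[THEN subsetD])
  have closed: "closed A" "closed B" by (auto simp: A_def B_def)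
  have inA: "A' \<inter> W \<subseteq> A" and inB: "B' \<inter> W \<subseteq> B" unfolding A_def B_def by (rule closure_subset)+
  then have "W \<subseteq> A \<union> B" using AB'(3) by blast
  then have cover: "knaster \<subseteq> A \<union> B" using W_dense closure_minimal[OF _ closed_Un[OF closed]] by blast
  have "A \<inter> knaster \<noteq> {}" "B \<inter> knaster \<noteq> {}"
    using AB'(5,6) W_subset_knaster inA inB by blast+
  define F where "F = A \<inter> B \<inter> knaster"
  have "F \<noteq> {}"
    using connected_knaster closed cover \<open>A \<inter> knaster \<noteq> {}\<close> \<open>B \<inter> knaster \<noteq> {}\<close>
    unfolding connected_closed F_def by blast
  have closedF: "closed F" unfolding F_def using closed compact_imp_closed[OF compact_knaster]
    by (intro closed_Int)
  have "F \<inter> W = {}" using sub AB'(4) unfolding F_def by blast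
  then have Fholes: "F \<subseteq> (\<Union>i n. hole i n)" unfolding W_eq_knaster_minus_holes F_def by blast
  \<comment> \<open>By Baire, one of the countably many holes contains a relatively open part of \<open>F\<close>.\<close>
  have "\<exists>i n. \<not> F \<subseteq> closure (F - hole i n)"
  proof (rule ccontr)
    assume *: "\<not> (\<exists>i n. \<not> F \<subseteq> closure (F - hole i n))"
    have "F \<subseteq> closure (\<Inter>((\<lambda>(i, n). F - hole i n) ` UNIV))"
    proof (rule Baire[OF closedF])
      fix T assume "T \<in> (\<lambda>(i, n). F - hole i n) ` UNIV"
      then obtain i n where T: "T = F - hole i n" by auto
      have "T = F \<inter> - hole i n" using T by blast
      moreover have "open (- hole i n)" using compact_hole compact_imp_closed by blast
      ultimately have "openin (top_of_set F) T" by (simp add: openin_open_Int)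
      then show "openin (top_of_set F) T \<and> F \<subseteq> closure T" using * T by blast
    qed simp
    moreover have "\<Inter>((\<lambda>(i, n). F - hole i n) ` UNIV) = {}" using Fholes by auto
    ultimately show False using \<open>F \<noteq> {}\<close> by simp
  qed
  then obtain i n p where p: "p \<in> F" "p \<notin> closure (F - hole i n)" by blast
  define U where "U = - closure (F - hole i n)"
  have U: "open U" "p \<in> U" "U \<inter> F \<subseteq> hole i n" using p closure_subset[of "F - hole i n"] by (auto simp: U_def)
  then obtain c0 r0 where cr: "(c0, r0) \<in> \<Gamma> (q n)" "p = chart i (c0, r0)" using p(1) unfolding hole_def by auto
  have c0: "c0 \<in> cantor" using cr(1) Gamma_subset by blast
  obtain e1 where e1: "0 < e1" "\<And>c r. c \<in> cantor \<Longrightarrow> dist (c, r) (c0, r0) < e1 \<Longrightarrow> chart i (c, r) \<in> U"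
  proof -
    obtain V where V: "open V" "chart i -` U \<inter> cantor \<times> UNIV = V \<inter> cantor \<times> UNIV"
      using continuous_on_open_invariant[THEN iffD1, OF continuous_chart[of i]] U(1) by (metis inf_commute)
    have "(c0, r0) \<in> V" using V(2) c0 U(2) cr(2) by blast
    then obtain e where "0 < e" "\<And>y. dist y (c0, r0) < e \<Longrightarrow> y \<in> V" using V(1) open_dist by blast
    then show ?thesis using that[of e] V(2) by blast
  qed
  define e0 where "e0 = e1 / 2"
  have e0: "0 < e0" using e1(1) by (simp add: e0_def)
  have inU: "chart i (c, r) \<in> U" if "c \<in> cantor" "\<bar>c - c0\<bar> < e0" "\<bar>r - r0\<bar> < e0" for c r
  proof (rule e1(2)[OF that(1)])
    have "dist (c, r) (c0, r0) \<le> \<bar>c - c0\<bar> + \<bar>r - r0\<bar>"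
      unfolding dist_Pair_Pair dist_real_def by (metis real_sqrt_abs sqrt_sum_squares_le_sum_abs power2_abs)
    then show "dist (c, r) (c0, r0) < e1" using that by (simp add: e0_def)
  qed
  have split: "chart i (c, r) \<in> A \<longleftrightarrow> chart i (c, r) \<notin> B"
    if "c \<in> cantor" "\<bar>c - c0\<bar> < e0" "\<bar>r - r0\<bar> < e0" "(c, r) \<notin> \<Gamma> (q n)" for c r
  proof -
    have K: "chart i (c, r) \<in> knaster" using chart_in_knaster that(1) .
    have "chart i (c, r) \<notin> hole i n" using chart_in_hole_iff[OF that(1)] that(4) by simp
    then have "chart i (c, r) \<notin> F" using inU[OF that(1-3)] U(3) by blast
    then show ?thesis using K cover unfolding F_def by blast
  qed
  define L where "L x \<longleftrightarrow> chart i x \<in> A" for x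
  obtain D e b where box: "0 < D" "D \<le> e0" "0 < e" "e < e0"
    "\<And>c s. c \<in> cantor \<Longrightarrow> \<bar>c - c0\<bar> < D \<Longrightarrow> \<bar>s - r0\<bar> < e \<Longrightarrow> (c, s) \<notin> \<Gamma> (q n) \<Longrightarrow> L (c, s) = b"
  proof (rule box_minus_Gamma_unsplit[OF cr(1) e0, of L])
    fix c1 r1 assume c1: "c1 \<in> cantor" "\<bar>c1 - c0\<bar> < e0" "\<bar>r1 - r0\<bar> < e0" "(c1, r1) \<notin> \<Gamma> (q n)"
    define G where "G = (if L (c1, r1) then - B else - A)"
    have G: "open G" "chart i (c1, r1) \<in> G" using closed split[OF c1] by (auto simp: G_def L_def)
    have "continuous_on cantor (\<lambda>c. chart i (c, r1))"
      by (rule continuous_on_compose2[OF continuous_chart]) (auto intro!: continuous_intros)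
    then have "((\<lambda>c. chart i (c, r1)) \<longlongrightarrow> chart i (c1, r1)) (at c1 within cantor)"
      using c1(1) unfolding continuous_on_def by blast
    from topological_tendstoD[OF this G]
    have 1: "\<forall>\<^sub>F c in at c1 within cantor. chart i (c, r1) \<in> G" .
    have "((\<lambda>c. (c, r1)) \<longlongrightarrow> (c1, r1)) (at c1 within cantor)" by (intro tendsto_intros)
    moreover have "open (- \<Gamma> (q n))" "(c1, r1) \<in> - \<Gamma> (q n)" using c1(4) by auto
    ultimately have 2: "\<forall>\<^sub>F c in at c1 within cantor. (c, r1) \<in> - \<Gamma> (q n)" by (rule topological_tendstoD)
    have "((\<lambda>c. \<bar>c - c0\<bar>) \<longlongrightarrow> \<bar>c1 - c0\<bar>) (at c1 within cantor)" by (intro tendsto_intros)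
    then have 3: "\<forall>\<^sub>F c in at c1 within cantor. \<bar>c - c0\<bar> < e0" using c1(2) by (rule order_tendstoD)
    from eventually_conj[OF 1 eventually_conj[OF 2 3]]
    obtain D where D: "0 < D" "\<And>c. c \<in> cantor \<Longrightarrow> c \<noteq> c1 \<Longrightarrow> dist c c1 < D \<Longrightarrow>
        chart i (c, r1) \<in> G \<and> (c, r1) \<in> - \<Gamma> (q n) \<and> \<bar>c - c0\<bar> < e0"
      unfolding eventually_at by blast
    have "(c, r1) \<notin> \<Gamma> (q n) \<and> L (c, r1) = L (c1, r1)" if c: "c \<in> cantor" "\<bar>c - c1\<bar> < D" for c
    proof (cases "c = c1")
      case False
      then have *: "chart i (c, r1) \<in> G" "(c, r1) \<notin> \<Gamma> (q n)" "\<bar>c - c0\<bar> < e0"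
        using D(2)[OF c(1) False] c(2) by (auto simp: dist_real_def)
      then show ?thesis using split[OF c(1) *(3) c1(3) *(2)] by (auto simp: G_def L_def split: if_splits)
    qed (use c1 in simp)
    then show "\<exists>D>0. \<forall>c\<in>cantor. \<bar>c - c1\<bar> < D \<longrightarrow> (c, r1) \<notin> \<Gamma> (q n) \<and> L (c, r1) = L (c1, r1)"
      using D(1) by blast
  next
    fix c r1 r2 assume c: "c \<in> cantor" "\<bar>c - c0\<bar> < e0" "\<bar>r1 - r0\<bar> < e0" "\<bar>r2 - r0\<bar> < e0" "r1 \<le> r2"
      and free: "\<And>x. r1 \<le> x \<Longrightarrow> x \<le> r2 \<Longrightarrow> (c, x) \<notin> \<Gamma> (q n)"
    define J where "J = (\<lambda>x. chart i (c, x)) ` {r1..r2}"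
    have "continuous_on {r1..r2} (\<lambda>x. chart i (c, x))"
      by (rule continuous_on_compose2[OF continuous_chart]) (use c(1) in \<open>auto intro!: continuous_intros\<close>)
    then have "connected J" unfolding J_def by (rule connected_continuous_image) simp
    moreover have "J \<subseteq> A \<union> B" using chart_in_knaster[OF c(1)] cover unfolding J_def by blast
    moreover have "A \<inter> B \<inter> J = {}"
    proof -
      have "chart i (c, x) \<in> A \<longleftrightarrow> chart i (c, x) \<notin> B" if "x \<in> {r1..r2}" for x
        using split[OF c(1,2)] free that c(3,4) by auto
      then show ?thesis unfolding J_def by blast
    qed
    ultimately have "A \<inter> J = {} \<or> B \<inter> J = {}" using closed unfolding connected_closed by blast
    moreover have "chart i (c, r1) \<in> J" "chart i (c, r2) \<in> J" using c(5) by (auto simp: J_def)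
    ultimately show "L (c, r1) = L (c, r2)" using \<open>J \<subseteq> A \<union> B\<close> unfolding L_def by blast
  qed (rule that)
  \<comment> \<open>The image of the box is a neighbourhood of \<open>p\<close>, so it contains points of \<open>W\<close> from both parts;
    but all points of \<open>W\<close> in it lie on the same side.\<close>
  define V where "V = {c0 - D<..<c0 + D} \<times> {height (r0 - e)<..<height (r0 + e)}"
  define Z where "Z = knaster - knaster_chart i ` (V \<inter> cantor \<times> {0<..<1})"
  have "open V" unfolding V_def by (intro open_Times) auto
  then have "open (- Z)" unfolding Z_def using chart_open by blast
  have "p \<in> - Z"
  proof -
    have "(c0, height r0) \<in> V \<inter> cantor \<times> {0<..<1}"
      using c0 height_bounds[of r0] box(1,3) by (auto simp: V_def height_less_iff)
    then show ?thesis unfolding Z_def cr(2) chart_eq by blast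
  qed
  have near: "(w \<in> A \<longleftrightarrow> b) \<and> (w \<in> A \<longleftrightarrow> w \<notin> B)"
    if w: "w \<in> W" "w \<in> - Z" for w
  proof -
    obtain c t where ct: "c \<in> cantor" "t \<in> {0<..<1}" "(c, t) \<in> V" "w = knaster_chart i (c, t)"
      using w W_subset_knaster unfolding Z_def by auto
    obtain s where s: "height s = t" using height_surj[OF ct(2)] .
    have cs: "\<bar>c - c0\<bar> < D" "\<bar>s - r0\<bar> < e"
      using ct(3) unfolding V_def s[symmetric] by (auto simp: height_less_iff)
    have wc: "w = chart i (c, s)" using ct(4) s by (simp add: chart_eq)
    have free: "(c, s) \<notin> \<Gamma> (q n)"
      using w(1) chart_in_hole_iff[OF ct(1), of i s i n] unfolding wc W_eq_knaster_minus_holes by blast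
    moreover have "\<bar>c - c0\<bar> < e0" "\<bar>s - r0\<bar> < e0" using cs box(2,4) by auto
    ultimately show ?thesis using box(5)[OF ct(1) cs free] split[OF ct(1) _ _ free] unfolding wc L_def by blast
  qed
  have "p \<in> A" "p \<in> B" using p(1) by (auto simp: F_def)
  then have "- Z \<inter> (A' \<inter> W) \<noteq> {}" "- Z \<inter> (B' \<inter> W) \<noteq> {}"
    using open_Int_closure_eq_empty[OF \<open>open (- Z)\<close>] \<open>p \<in> - Z\<close> unfolding A_def B_def by blast+
  then obtain w w' where w: "w \<in> - Z" "w \<in> A'" "w \<in> W" and w': "w' \<in> - Z" "w' \<in> B'" "w' \<in> W" by blast
  have "w \<in> A" "w' \<in> B" using w w' inA inB by blast+
  then show False using near[OF w(3,1)] near[OF w'(3,1)] by blast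
qed

lemma widely_connected_W: "widely_connected_space (W_space (X3 d a q))"
proof -
  have "(0, 0) \<in> W" "(1, 1) \<in> W"
    using cantor_zero cantor_one by (auto simp: W_eq knaster_diagonal_def)
  then have "\<exists>x\<in>W. \<exists>y\<in>W. x \<noteq> y" by (metis fst_conv zero_neq_one)
  moreover have "W \<inter> closure (W \<inter> S) = W" if "connected S" "S \<subseteq> W" "\<exists>x\<in>S. \<exists>y\<in>S. x \<noteq> y" for S
  proof -
    from that(3) obtain x y where "x \<in> S" "y \<in> S" "x \<noteq> y" by blast
    then have "W \<subseteq> closure S" by (rule dense_if_connected[OF that(1,2)])
    moreover have "W \<inter> S = S" using that(2) by blast
    ultimately show ?thesis by (simp add: Int_absorb2)
  qed
  ultimately show ?thesis
    unfolding widely_connected_space_def W_space_eq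
    by (auto simp: connected_W connectedin_subtopology closure_of_subtopology connected_space_subtopology)
qed

end

theorem theorem4:
  fixes d a q :: "nat \<Rightarrow> real"
  assumes "inj d"
    and "range d \<subseteq> cantor_nonendpoints"
    and "top_of_set cantor closure_of range d = cantor"
    and "\<And>n. a n > 0"
    and "a sums 1"
    and "range q = \<rat>"
  shows "widely_connected_space (W_space (X3 d a q)) \<and>
         completely_metrizable_space (W_space (X3 d a q))"
proof -
  interpret punctured d a q
    using assms by unfold_locales
  show ?thesis using widely_connected_W completely_metrizable_W by blast
qed

end
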